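(* Let $n=a+m+b$ with $m\ge2$ and $a,b\ge0$, and let $H_{a,m,b}$ be the hat. Then \[ X_{H_{a,m,b}}=\sum_{\substack{K\vDash n\\ N_K\le-1}}\frac{-N_K\,w_K\,e_K}{\Theta_K^+(b+m)+\Theta_K^-(b+m-1)}+\sum_{\substack{K\vDash n\\ N_K\ge1}}N_K\,w_K\,e_K+\sum_{(I,J)\in\mathcal S_{a,m,b}}\bigl(m-1-|I|\bigr)w_Iw_J\,e_{IJ}, \] where $N_K=\Theta_K^+(b+1)-\Theta_K^+(b+m)$, and, writing $J=J_1J_2$ for the bisection of a composition $J$ with $|J_1|=\sigma_J^+(b+1)$, \begin{align*} \mathcal S_{a,m,b}&=\{(I,J):K=J_1\overline IJ_2\vDash n,\ i_1\ne1,\ |J_1|\le b+m-1,\ 2\le|I|\le m-2,\ |J_2|\le\sigma^-_{\overline K}(a)-1\}\\ &\quad\cup\{(I,J):K=J_1\overline IJ_2\vDash n,\ i_1\ne1,\ |J_1|\ge b+m,\ 2\le|I|\le m-2\}\\ &\quad\cup\{(I,J):IJ\vDash n,\ i_1=1,\ |I|\le m-2,\ |J_2|\le a-1\}. \end{align*}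
   Context: The hat $H_{a,m,b}$ is the graph obtained from the path $v_1\cdots v_n$ by adding the edge $v_{a+1}v_{a+m}$. A composition $I=i_1\cdots i_s\vDash n$ is a sequence of positive integers with sum $n$; $|I|$ is its sum; $\overline I=i_s\cdots i_1$ its reversal; $IJ$ the concatenation; $e_I=e_{i_1}\cdots e_{i_s}$ (elementary symmetric functions); $w_I=i_1\prod_{j\ge2}(i_j-1)$. For $0\le c\le |I|$: $\sigma_I^+(c)=\min\{i_1+\dots+i_k:0\le k\le s,\ i_1+\dots+i_k\ge c\}$, $\Theta_I^+(c)=\sigma_I^+(c)-c$; for $c\ge0$: $\sigma_I^-(c)=\max\{i_1+\dots+i_k:0\le k\le s,\ i_1+\dots+i_k\le c\}$, $\Theta_I^-(c)=c-\sigma_I^-(c)$. In $\mathcal S_{a,m,b}$, $I$ and $J$ are compositions, $i_1$ is the first part of $I$, and $J_1,J_2$ are defined from $J$ as stated ($J_2$ may be empty). The chromatic symmetric function is $X_G=\sum_\kappa\prod_{v}x_{\kappa(v)}$ over proper colorings $\kappa$. *)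

theory Defs
  imports Complex_Main "HOL-Library.Multiset" "HOL-Library.FuncSet"
begin

subsection \<open>Formal power series in commuting variables indexed by a type\<close>

text \<open>
  A monomial in the variables $x_v$ is the multiset of its variables; a formal power series (with
  possibly infinitely many variables and infinitely many terms) is an arbitrary function assigning
  a coefficient to each monomial. A monomial has only finitely many divisors, so the
  convolution product is given by finite sums.
\<close>

typedef ('v, 'a) mpseries = "UNIV :: ('v multiset \<Rightarrow> 'a) set"
  morphisms mpcoeff Abs_mpseries
  by simp

setup_lifting type_definition_mpseries

lemma mpseries_eqI: "(\<And>M. mpcoeff f M = mpcoeff g M) \<Longrightarrow> f = g"
  by transfer auto

lemma finite_msubsets: "finite {A. A \<subseteq># (M :: 'v multiset)}"
proof (induction M)
  case (add x M)
  have "{A. A \<subseteq># add_mset x M} \<subseteq> {A. A \<subseteq># M} \<union> add_mset x ` {A. A \<subseteq># M}"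
  proof
    fix A assume "A \<in> {A. A \<subseteq># add_mset x M}"
    hence A: "A \<subseteq># add_mset x M" by simp
    show "A \<in> {A. A \<subseteq># M} \<union> add_mset x ` {A. A \<subseteq># M}"
    proof (cases "x \<in># A")
      case True
      then obtain B where "A = add_mset x B" by (meson mset_add)
      thus ?thesis using A by auto
    next
      case False
      hence "A \<subseteq># M" using A
        by (metis diff_single_trivial subset_eq_diff_conv add_mset_add_single)
      thus ?thesis by simp
    qed
  qed
  thus ?case using add.IH finite_subset by blast
qed simp

instantiation mpseries :: (type, comm_ring_1) comm_ring_1
begin

lift_definition zero_mpseries :: "('a, 'b) mpseries" is "\<lambda>_. 0" .

lift_definition one_mpseries :: "('a, 'b) mpseries" is "\<lambda>M. if M = {#} then 1 else 0" .

lift_definition plus_mpseries :: "('a, 'b) mpseries \<Rightarrow> ('a, 'b) mpseries \<Rightarrow> ('a, 'b) mpseries"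
  is "\<lambda>f g M. f M + g M" .

lift_definition minus_mpseries :: "('a, 'b) mpseries \<Rightarrow> ('a, 'b) mpseries \<Rightarrow> ('a, 'b) mpseries"
  is "\<lambda>f g M. f M - g M" .

lift_definition uminus_mpseries :: "('a, 'b) mpseries \<Rightarrow> ('a, 'b) mpseries"
  is "\<lambda>f M. - f M" .

lift_definition times_mpseries :: "('a, 'b) mpseries \<Rightarrow> ('a, 'b) mpseries \<Rightarrow> ('a, 'b) mpseries"
  is "\<lambda>f g M. \<Sum>A | A \<subseteq># M. f A * g (M - A)" .

instance
proof
  fix f g h :: "('a, 'b) mpseries"
  show "f * g * h = f * (g * h)"
  proof (rule mpseries_eqI)
    fix M :: "'a multiset"
    have "mpcoeff (f * g * h) M =
        (\<Sum>A | A \<subseteq># M. \<Sum>B | B \<subseteq># A. mpcoeff f B * mpcoeff g (A - B) * mpcoeff h (M - A))"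
      by (simp add: times_mpseries.rep_eq sum_distrib_right)
    also have "\<dots> = (\<Sum>(A, B) \<in> (SIGMA A:{A. A \<subseteq># M}. {B. B \<subseteq># A}).
        mpcoeff f B * mpcoeff g (A - B) * mpcoeff h (M - A))"
      by (subst sum.Sigma) (auto simp: finite_msubsets)
    also have "\<dots> = (\<Sum>(B, C) \<in> (SIGMA B:{B. B \<subseteq># M}. {C. C \<subseteq># M - B}).
        mpcoeff f B * (mpcoeff g C * mpcoeff h (M - B - C)))"
    proof (rule sum.reindex_bij_witness[where i = "\<lambda>(B, C). (B + C, B)" and j = "\<lambda>(A, B). (B, A - B)"],
        goal_cases)
      case (1 p)
      thus ?case by auto
    next
      case (2 p)
      then obtain A B where p: "p = (A, B)" "A \<subseteq># M" "B \<subseteq># A" by auto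
      hence "A - B \<subseteq># M - B" "B \<subseteq># M"
        by (auto simp: subseteq_mset_def intro: diff_le_mono order_trans)
      with p show ?case by auto
    next
      case (3 p)
      thus ?case by auto
    next
      case (4 p)
      then obtain B C where p: "p = (B, C)" "B \<subseteq># M" "C \<subseteq># M - B" by auto
      hence "B + C \<subseteq># M"
        using subset_mset.add_left_mono[of C "M - B" B] by simp
      with p show ?case by auto
    next
      case (5 p)
      then obtain A B where "p = (A, B)" "B \<subseteq># A" by auto
      moreover from this have "M - B - (A - B) = M - A"
        by (simp add: diff_diff_add_mset)
      ultimately show ?case by (simp add: mult.assoc)
    qed
    also have "\<dots> = (\<Sum>B | B \<subseteq># M. \<Sum>C | C \<subseteq># M - B.
        mpcoeff f B * (mpcoeff g C * mpcoeff h (M - B - C)))"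
      by (subst sum.Sigma) (auto simp: finite_msubsets)
    also have "\<dots> = mpcoeff (f * (g * h)) M"
      by (simp add: times_mpseries.rep_eq sum_distrib_left)
    finally show "mpcoeff (f * g * h) M = mpcoeff (f * (g * h)) M" .
  qed
  show "f * g = g * f"
  proof (rule mpseries_eqI)
    fix M :: "'a multiset"
    have *: "M - (M - A) = A" if "A \<subseteq># M" for A
      using that by (simp add: multiset_eq_iff subseteq_mset_def)
    show "mpcoeff (f * g) M = mpcoeff (g * f) M"
      unfolding times_mpseries.rep_eq
      by (rule sum.reindex_bij_witness[where i = "\<lambda>A. M - A" and j = "\<lambda>A. M - A"])
         (auto simp: * mult.commute)
  qed
  show "1 * f = f"
  proof (rule mpseries_eqI)
    fix M :: "'a multiset"
    have "mpcoeff (1 * f) M = (\<Sum>A | A \<subseteq># M. if A = {#} then mpcoeff f M else 0)"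
      unfolding times_mpseries.rep_eq one_mpseries.rep_eq
      by (rule sum.cong) auto
    also have "\<dots> = mpcoeff f M"
      by (subst sum.delta) (auto simp: finite_msubsets)
    finally show "mpcoeff (1 * f) M = mpcoeff f M" .
  qed
  show "f + g + h = f + (g + h)" "f + g = g + f" "0 + f = f" "- f + f = 0" "f - g = f + - g"
    by (rule mpseries_eqI;
        simp add: plus_mpseries.rep_eq minus_mpseries.rep_eq uminus_mpseries.rep_eq
          zero_mpseries.rep_eq add_ac)+
  show "(f + g) * h = f * h + g * h"
    by transfer (simp add: distrib_right sum.distrib)
  show "(0 :: ('a, 'b) mpseries) \<noteq> 1"
    by transfer (metis zero_neq_one)
qed

end

lift_definition mpconst :: "'a::zero \<Rightarrow> ('v, 'a) mpseries"
  is "\<lambda>c M. if M = {#} then c else 0" .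


subsection \<open>Elementary and chromatic symmetric functions\<close>

lift_definition elem_sym :: "nat \<Rightarrow> (nat, rat) mpseries"
  is "\<lambda>k M. if size M = k \<and> (\<forall>x. count M x \<le> 1) then 1 else 0" .

definition elem_sym_comp :: "nat list \<Rightarrow> (nat, rat) mpseries" where
  "elem_sym_comp I = prod_list (map elem_sym I)"

text \<open>A graph is a pair of a vertex set and a set of two-element sets of vertices; the colours,
  which index the variables, are the natural numbers.\<close>

type_synonym 'v graph = "'v set \<times> 'v set set"

definition proper_colorings :: "'v graph \<Rightarrow> ('v \<Rightarrow> nat) set" where
  "proper_colorings G =
     {\<kappa> \<in> fst G \<rightarrow>\<^sub>E UNIV. \<forall>u v. {u, v} \<in> snd G \<longrightarrow> \<kappa> u \<noteq> \<kappa> v}"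

text \<open>Each coloring $\kappa$ contributes the monomial $\prod_v x_{\kappa(v)}$, so the coefficient
  of a monomial in the infinite sum over all $\kappa$ is the (finite) number of proper colorings
  contributing that monomial.\<close>

lift_definition chromatic_sym :: "'v graph \<Rightarrow> (nat, rat) mpseries"
  is "\<lambda>G M. of_nat (card {\<kappa> \<in> proper_colorings G. image_mset \<kappa> (mset_set (fst G)) = M})" .

definition hat_graph :: "nat \<Rightarrow> nat \<Rightarrow> nat \<Rightarrow> nat graph" where
  "hat_graph a m b =
     ({1..a + m + b}, {{i, i + 1} | i. 1 \<le> i \<and> i < a + m + b} \<union> {{a + 1, a + m}})"


subsection \<open>Compositions\<close>

definition compositions :: "nat \<Rightarrow> nat list set" where
  "compositions n = {I. (\<forall>i\<in>set I. 0 < i) \<and> sum_list I = n}"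

fun comp_weight :: "nat list \<Rightarrow> int" where
  "comp_weight [] = 1"
| "comp_weight (i # I) = int i * (\<Prod>j\<leftarrow>I. int j - 1)"

text \<open>Used only for \<open>c \<le> sum_list I\<close>; otherwise the minimum is over the empty set.\<close>

definition sigma_plus :: "nat list \<Rightarrow> nat \<Rightarrow> nat" where
  "sigma_plus I c =
     Min {sum_list (take k I) | k. k \<le> length I \<and> c \<le> sum_list (take k I)}"

definition Theta_plus :: "nat list \<Rightarrow> nat \<Rightarrow> int" where
  "Theta_plus I c = int (sigma_plus I c) - int c"

definition sigma_minus :: "nat list \<Rightarrow> nat \<Rightarrow> nat" where
  "sigma_minus I c =
     Max {sum_list (take k I) | k. k \<le> length I \<and> sum_list (take k I) \<le> c}"

definition Theta_minus :: "nat list \<Rightarrow> nat \<Rightarrow> int" where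
  "Theta_minus I c = int c - int (sigma_minus I c)"

definition hat_N :: "nat \<Rightarrow> nat \<Rightarrow> nat list \<Rightarrow> int" where
  "hat_N m b K = Theta_plus K (b + 1) - Theta_plus K (b + m)"

definition bisection :: "nat \<Rightarrow> nat list \<Rightarrow> nat list \<Rightarrow> nat list \<Rightarrow> bool" where
  "bisection b J J1 J2 \<longleftrightarrow> J = J1 @ J2 \<and> sum_list J1 = sigma_plus J (b + 1)"

text \<open>Upper bounds of the form \<open>x \<le> y - c\<close> are written \<open>x + c \<le> y\<close>, since subtraction on
  naturals is truncated.\<close>

definition hat_S :: "nat \<Rightarrow> nat \<Rightarrow> nat \<Rightarrow> (nat list \<times> nat list) set" where
  "hat_S a m b =
     {(I, J). \<exists>J1 J2 K. bisection b J J1 J2 \<and> K = J1 @ rev I @ J2 \<and> K \<in> compositions (a + m + b) \<and>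
        hd I \<noteq> 1 \<and> sum_list J1 + 1 \<le> b + m \<and> 2 \<le> sum_list I \<and> sum_list I + 2 \<le> m \<and>
        sum_list J2 + 1 \<le> sigma_minus (rev K) a}
   \<union> {(I, J). \<exists>J1 J2 K. bisection b J J1 J2 \<and> K = J1 @ rev I @ J2 \<and> K \<in> compositions (a + m + b) \<and>
        hd I \<noteq> 1 \<and> b + m \<le> sum_list J1 \<and> 2 \<le> sum_list I \<and> sum_list I + 2 \<le> m}
   \<union> {(I, J). \<exists>J1 J2. bisection b J J1 J2 \<and> I @ J \<in> compositions (a + m + b) \<and>
        I \<noteq> [] \<and> hd I = 1 \<and> sum_list I + 2 \<le> m \<and> sum_list J2 + 1 \<le> a}"

lemma finite_compositions: "finite (compositions n)"
proof -
  have "length I \<le> sum_list I" if "\<forall>i\<in>set I. 0 < i" for I :: "nat list"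
    using that by (induction I) auto
  hence "compositions n \<subseteq> {I. set I \<subseteq> {..n} \<and> length I \<le> n}"
    by (auto simp: compositions_def intro: member_le_sum_list)
  thus ?thesis using finite_lists_length_le[of "{..n}" n] finite_subset by blast
qed

lemma finite_hat_S: "finite (hat_S a m b)"
proof -
  have "hat_S a m b \<subseteq>
    (\<Union>i\<le>a + m + b. compositions i) \<times> (\<Union>i\<le>a + m + b. compositions i)"
    by (auto simp: hat_S_def bisection_def compositions_def)
  thus ?thesis using finite_compositions
    by (meson finite_SigmaI finite_UN_I finite_atMost finite_subset)
qed

end

theory Submission
  imports Defs "HOL-Computational_Algebra.Formal_Power_Series"
begin

text \<open>
  Let \<open>P\<^sub>n\<close> be the chromatic symmetric function of the path and \<open>R\<^sub>n\<close> the sum of \<open>\<Prod>\<^sub>j (i\<^sub>j - 1) e\<^sub>I\<close> over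
  the compositions \<open>I\<close> of \<open>n\<close>. Triple deletion writes the hat with \<open>m = q + 1\<close>, \<open>c = a + m\<close> and
  \<open>n = b + c\<close> as
  \<open>q P\<^sub>n + \<Sum>\<^sub>i (q - i) P\<^sub>i P\<^bsub>n-i\<^esub> - \<Sum>\<^sub>s ((q - s) P\<^bsub>b+s\<^esub> + T\<^sub>s) P\<^bsub>c-s\<^esub>\<close> with \<open>1 \<le> i, s \<le> q\<close>, where
  \<open>T\<^sub>s\<close> belongs to the tadpole made of an \<open>s\<close>-cycle and a tail of length \<open>b\<close>.

  Cut every composition after the part that reaches the height \<open>b + 1\<close>, and let \<open>D\<^sub>p\<close> collect the
  initial pieces of sum \<open>b + p\<close>. Then \<open>P\<^bsub>b+t\<^esub> = \<Sum>\<^sub>p D\<^sub>p R\<^bsub>t-p\<^esub>\<close>, so both sides of the claim have the form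
  \<open>\<Sum>\<^sub>p D\<^sub>p Q\<^sub>p\<close>; on the right the three families that form \<open>\<S>\<close> merge into the single condition
  \<open>p + |I| - i\<^sub>1 \<ge> m\<close>. The factors \<open>Q\<^sub>p\<close> are linear combinations of \<open>R\<^sub>r e\<^sub>k R\<^sub>t\<close> with \<open>r + k + t = c - p\<close>,
  and they agree because a composition crosses the height \<open>m - p\<close> exactly once and because
  \<open>\<Sum>\<^sub>j C\<^sub>j R\<^bsub>n-j\<^esub> = n R\<^sub>n\<close> for the chromatic symmetric functions \<open>C\<^sub>j\<close> of the cycles.
\<close>

subsection \<open>Sums over compositions\<close>

unbundle fps_syntax

lemma compositions_0: "compositions 0 = {[]}"
proof -
  have "I = []" if "\<forall>i\<in>set I. 0 < i" "sum_list I = 0" for I :: "nat list"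
    using that by (cases I) auto
  thus ?thesis by (auto simp: compositions_def)
qed

lemma Cons_in_compositions: "k # A \<in> compositions n \<longleftrightarrow> 1 \<le> k \<and> k \<le> n \<and> A \<in> compositions (n - k)"
  by (auto simp: compositions_def)

lemma append_in_compositions:
  "A @ B \<in> compositions n \<longleftrightarrow>
     A \<in> compositions (sum_list A) \<and> sum_list A \<le> n \<and> B \<in> compositions (n - sum_list A)"
  by (auto simp: compositions_def)

lemma compositionsD: "K \<in> compositions n \<Longrightarrow> sum_list K = n"
  by (simp add: compositions_def)

lemma sum_compositions_Cons:
  assumes "1 \<le> n"
  shows "sum f (compositions n) = (\<Sum>k=1..n. \<Sum>A\<in>compositions (n - k). f (k # A))"
proof -
  have "bij_betw (\<lambda>(k, A). k # A) (SIGMA k:{1..n}. compositions (n - k)) (compositions n)"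
  proof (intro bij_betwI')
    fix K assume K: "K \<in> compositions n"
    with assms obtain k A where "K = k # A" by (cases K) (auto simp: compositions_def)
    with K show "\<exists>x\<in>SIGMA k:{1..n}. compositions (n - k). K = (case x of (k, A) \<Rightarrow> k # A)"
      by (force simp: Cons_in_compositions)
  qed (auto simp: Cons_in_compositions)
  from sum.reindex_bij_betw[OF this, of f] show ?thesis
    by (simp add: sum.Sigma finite_compositions split_def)
qed

section \<open>Cutting a composition at a height\<close>

lemma crossing_exists:
  assumes "1 \<le> c" "c \<le> sum_list K"
  shows "\<exists>A k B. K = A @ k # B \<and> sum_list A < c \<and> c \<le> sum_list A + (k::nat)"
  using assms
proof (induction K arbitrary: c)
  case (Cons k K)
  show ?case
  proof (cases "c \<le> k")
    case True
    with Cons.prems show ?thesis by (intro exI[of _ "[]"]) auto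
  next
    case False
    hence "1 \<le> c - k" "c - k \<le> sum_list K" using Cons.prems by auto
    then obtain A j B where "K = A @ j # B" "sum_list A < c - k" "c - k \<le> sum_list A + j"
      using Cons.IH by blast
    with False show ?thesis by (intro exI[of _ "k # A"]) auto
  qed
qed simp

lemma crossing_unique:
  fixes k :: nat
  assumes "A @ k # B = A' @ k' # B'" "sum_list A < c" "c \<le> sum_list A + k"
    and "sum_list A' < c" "c \<le> sum_list A' + k'"
  shows "A = A' \<and> k = k' \<and> B = B'"
  using assms by (auto simp: append_eq_append_conv2 Cons_eq_append_conv append_eq_Cons_conv)

text \<open>The part that carries the partial sums from below \<open>c\<close> to at least
  \<open>c\<close> exists and is unique; the pieces around it are arbitrary compositions of
  \<open>r\<close> and \<open>n - r - k\<close>.\<close>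

lemma sum_compositions_crossing:
  assumes "1 \<le> c" "c \<le> n"
  shows "sum f (compositions n) =
    (\<Sum>r<c. \<Sum>k=c - r..n - r. \<Sum>A\<in>compositions r. \<Sum>B\<in>compositions (n - r - k). f (A @ k # B))"
proof -
  let ?X = "SIGMA r:{..<c}. SIGMA k:{c - r..n - r}. compositions r \<times> compositions (n - r - k)"
  have "bij_betw (\<lambda>(r, k, A, B). A @ k # B) ?X (compositions n)"
  proof (intro bij_betwI')
    fix x y assume "x \<in> ?X" "y \<in> ?X"
    then obtain r k A B r' k' A' B' where *: "x = (r, k, A, B)" "y = (r', k', A', B')"
        "sum_list A = r" "r < c" "c \<le> r + k" "sum_list A' = r'" "r' < c" "c \<le> r' + k'"
      by (cases x; cases y) (auto dest!: compositionsD)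
    show "((case x of (r, k, A, B) \<Rightarrow> A @ k # B) = (case y of (r, k, A, B) \<Rightarrow> A @ k # B)) = (x = y)"
      using crossing_unique[of A k B A' k' B' c] * by auto
  next
    fix x assume "x \<in> ?X"
    then obtain r k A B where "x = (r, k, A, B)" "r < c" "c \<le> r + k" "k \<le> n - r"
        "A \<in> compositions r" "B \<in> compositions (n - r - k)"
      by auto
    moreover from this have "sum_list A = r" by (simp add: compositionsD)
    ultimately show "(case x of (r, k, A, B) \<Rightarrow> A @ k # B) \<in> compositions n"
      using assms by (auto simp: append_in_compositions Cons_in_compositions)
  next
    fix K assume K: "K \<in> compositions n"
    then obtain A k B where "K = A @ k # B" "sum_list A < c" "c \<le> sum_list A + k"
      using crossing_exists assms by (metis compositionsD)
    with K show "\<exists>x\<in>?X. K = (case x of (r, k, A, B) \<Rightarrow> A @ k # B)"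
      by (intro bexI[of _ "(sum_list A, k, A, B)"])
        (auto simp: append_in_compositions Cons_in_compositions)
  qed
  from sum.reindex_bij_betw[OF this, of f] show ?thesis
    by (simp add: sum.Sigma finite_compositions split_def sum.cartesian_product)
qed

lemma sigma_plus_crossing:
  assumes "sum_list A < c" "c \<le> sum_list A + k"
  shows "sigma_plus (A @ k # B) c = sum_list A + k"
  unfolding sigma_plus_def
proof (rule Min_eqI)
  show "finite {sum_list (take j (A @ k # B)) | j.
      j \<le> length (A @ k # B) \<and> c \<le> sum_list (take j (A @ k # B))}"
    by simp
  show "sum_list A + k \<in> {sum_list (take j (A @ k # B)) | j.
      j \<le> length (A @ k # B) \<and> c \<le> sum_list (take j (A @ k # B))}"
    using assms by (auto intro!: exI[of _ "Suc (length A)"])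
next
  fix y assume "y \<in> {sum_list (take j (A @ k # B)) | j.
      j \<le> length (A @ k # B) \<and> c \<le> sum_list (take j (A @ k # B))}"
  then obtain j where j: "y = sum_list (take j (A @ k # B))" "c \<le> y" by auto
  show "sum_list A + k \<le> y"
  proof (cases "j \<le> length A")
    case True
    hence "y \<le> sum_list A"
      using j(1) sum_list_append[of "take j A" "drop j A"] by simp
    with j assms show ?thesis by simp
  next
    case False
    then obtain i where "j = Suc (length A + i)" by (metis less_imp_Suc_add not_le)
    thus ?thesis using j(1) by simp
  qed
qed

text \<open>The same crossing part seen from below. The height is \<open>c - 1\<close> because the
  sum before the part is strictly less than \<open>c\<close>; this is the shift in
  \<open>Theta_minus K (b + m - 1)\<close>.\<close>

lemma sigma_minus_crossing:
  assumes "sum_list A < c" "c \<le> sum_list A + k"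
  shows "sigma_minus (A @ k # B) (c - 1) = sum_list A"
  unfolding sigma_minus_def
proof (rule Max_eqI)
  show "finite {sum_list (take j (A @ k # B)) | j.
      j \<le> length (A @ k # B) \<and> sum_list (take j (A @ k # B)) \<le> c - 1}"
    by simp
  show "sum_list A \<in> {sum_list (take j (A @ k # B)) | j.
      j \<le> length (A @ k # B) \<and> sum_list (take j (A @ k # B)) \<le> c - 1}"
    using assms by (auto intro!: exI[of _ "length A"])
next
  fix y assume "y \<in> {sum_list (take j (A @ k # B)) | j.
      j \<le> length (A @ k # B) \<and> sum_list (take j (A @ k # B)) \<le> c - 1}"
  then obtain j where j: "y = sum_list (take j (A @ k # B))" "y \<le> c - 1" by auto
  show "y \<le> sum_list A"
  proof (cases "j \<le> length A")
    case True
    thus ?thesis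
      using j(1) sum_list_append[of "take j A" "drop j A"] by simp
  next
    case False
    then obtain i where "j = Suc (length A + i)" by (metis less_imp_Suc_add not_le)
    thus ?thesis using j assms by simp
  qed
qed

text \<open>The factor that a piece contributes to \<open>comp_weight\<close> when a nonempty prefix
  precedes it.\<close>

definition reduced_weight :: "nat list \<Rightarrow> int" where
  "reduced_weight I = (\<Prod>j\<leftarrow>I. int j - 1)"

lemma reduced_weight_simps [simp]:
  "reduced_weight [] = 1"
  "reduced_weight (k # I) = (int k - 1) * reduced_weight I"
  "reduced_weight (I @ J) = reduced_weight I * reduced_weight J"
  by (simp_all add: reduced_weight_def)

lemma comp_weight_Cons: "comp_weight (k # I) = int k * reduced_weight I"
  by (simp add: reduced_weight_def)

lemma comp_weight_append: "A \<noteq> [] \<Longrightarrow> comp_weight (A @ B) = comp_weight A * reduced_weight B"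
  by (cases A) (auto simp: reduced_weight_def)

section \<open>Series of weighted compositions and their convolutions\<close>

context
  fixes e :: "nat \<Rightarrow> 'a :: comm_ring_1"
begin

definition path_series :: "nat \<Rightarrow> 'a" where
  "path_series n = (\<Sum>K\<in>compositions n. of_int (comp_weight K) * prod_list (map e K))"

definition reduced_series :: "nat \<Rightarrow> 'a" where
  "reduced_series n = (\<Sum>K\<in>compositions n. of_int (reduced_weight K) * prod_list (map e K))"

text \<open>For \<open>n \<ge> 1\<close> this is the sum of
  \<open>(i\<^sub>1 - 1) w\<^sub>I e\<^sub>I\<close> over the compositions of \<open>n\<close>, the
  elementary expansion of the cycle, with the first part \<open>k\<close> split off.\<close>

definition cycle_series :: "nat \<Rightarrow> 'a" where
  "cycle_series n = (\<Sum>k\<le>n. of_nat k * (of_nat k - 1) * e k * reduced_series (n - k))"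

text \<open>Collects the prefixes of sum \<open>b + p\<close> that end with the part reaching height \<open>b + 1\<close>.\<close>

definition head_series :: "nat \<Rightarrow> nat \<Rightarrow> 'a" where
  "head_series b p = (\<Sum>r\<le>b. \<Sum>A\<in>compositions r.
     of_int (comp_weight (A @ [b + p - r])) * prod_list (map e (A @ [b + p - r])))"

lemma reduced_series_0: "reduced_series 0 = 1"
  by (simp add: reduced_series_def compositions_0)

lemma reduced_series_rec:
  assumes "1 \<le> n"
  shows "reduced_series n = (\<Sum>k=1..n. (of_nat k - 1) * e k * reduced_series (n - k))"
  unfolding reduced_series_def sum_compositions_Cons[OF assms] sum_distrib_left
  by (simp add: algebra_simps)

lemma path_series_0: "path_series 0 = 1"
  by (simp add: path_series_def compositions_0)

lemma path_series_rec:
  assumes "1 \<le> n"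
  shows "path_series n = (\<Sum>k=1..n. of_nat k * e k * reduced_series (n - k))"
  unfolding path_series_def reduced_series_def sum_compositions_Cons[OF assms] sum_distrib_left
  by (simp add: algebra_simps comp_weight_Cons del: comp_weight.simps)

text \<open>Crossing at height \<open>b + 1\<close>, indexed by the overshoot \<open>p\<close> of
  the head above \<open>b\<close>; its last part is then \<open>b + p - r\<close>.\<close>

lemma sum_compositions_head:
  assumes "1 \<le> t"
  shows "sum f (compositions (b + t)) =
    (\<Sum>p=1..t. \<Sum>r\<le>b. \<Sum>A\<in>compositions r. \<Sum>B\<in>compositions (t - p). f ((A @ [b + p - r]) @ B))"
proof -
  have "sum f (compositions (b + t)) =
    (\<Sum>r\<le>b. \<Sum>p=1..t. \<Sum>A\<in>compositions r. \<Sum>B\<in>compositions (t - p). f ((A @ [b + p - r]) @ B))"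
  proof (subst sum_compositions_crossing[of "b + 1"])
    show "(\<Sum>r<b + 1. \<Sum>k=b + 1 - r..b + t - r. \<Sum>A\<in>compositions r.
          \<Sum>B\<in>compositions (b + t - r - k). f (A @ k # B)) =
        (\<Sum>r\<le>b. \<Sum>p=1..t. \<Sum>A\<in>compositions r. \<Sum>B\<in>compositions (t - p). f ((A @ [b + p - r]) @ B))"
    proof (rule sum.cong)
      fix r assume r: "r \<in> {..b}"
      show "(\<Sum>k=b + 1 - r..b + t - r. \<Sum>A\<in>compositions r.
          \<Sum>B\<in>compositions (b + t - r - k). f (A @ k # B)) =
        (\<Sum>p=1..t. \<Sum>A\<in>compositions r. \<Sum>B\<in>compositions (t - p). f ((A @ [b + p - r]) @ B))"
        using r by (intro sum.reindex_bij_witness[where i = "\<lambda>p. b + p - r" and j = "\<lambda>k. k + r - b"])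
          (auto simp: algebra_simps)
    qed auto
  qed (use assms in auto)
  also have "\<dots> = (\<Sum>p=1..t. \<Sum>r\<le>b. \<Sum>A\<in>compositions r. \<Sum>B\<in>compositions (t - p).
      f ((A @ [b + p - r]) @ B))"
    by (rule sum.swap)
  finally show ?thesis .
qed

lemma path_series_head:
  assumes "1 \<le> t"
  shows "path_series (b + t) = (\<Sum>p=1..t. head_series b p * reduced_series (t - p))"
  unfolding path_series_def sum_compositions_head[OF assms] head_series_def reduced_series_def
    sum_distrib_right
  unfolding sum_distrib_left
  by (simp add: comp_weight_append mult_ac del: comp_weight.simps append_assoc)

text \<open>Let \<open>F\<close> and \<open>U\<close> be the generating functions of
  \<open>(k - 1) e\<^sub>k\<close> and \<open>k e\<^sub>k\<close> over \<open>k \<ge> 1\<close>.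
  Then \<open>R = 1 / (1 - F)\<close>, \<open>P = 1 + U R\<close> and \<open>C = z F' R\<close>,
  hence \<open>C R = z R'\<close>, \<open>C P = z P' - P + 1\<close> and
  \<open>(1 - F) P = 1 + U - F\<close>. The claims are the coefficients of these identities.\<close>

lemma
  shows cycle_reduced_convolution:
      "(\<Sum>j\<le>n. cycle_series j * reduced_series (n - j)) = of_nat n * reduced_series n"
    and cycle_path_convolution:
      "1 \<le> n \<Longrightarrow> (\<Sum>j\<le>n. cycle_series j * path_series (n - j)) = (of_nat n - 1) * path_series n"
    and path_series_last:
      "1 \<le> n \<Longrightarrow> path_series n = e n + (\<Sum>k=1..n. (of_nat k - 1) * e k * path_series (n - k))"
proof -
  \<comment> \<open>No composition has a part 0, so the constant term is cut off; the formula alone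
    would give \<open>- e 0\<close>.\<close>
  define F where "F = Abs_fps (\<lambda>k. if k = 0 then 0 else (of_nat k - 1) * e k)"
  define U where "U = Abs_fps (\<lambda>k. of_nat k * e k)"
  define R where "R = Abs_fps reduced_series"
  define P where "P = Abs_fps path_series"
  define C where "C = Abs_fps cycle_series"
  have first: "(\<Sum>i=0..n. (if i = 0 then 0 else g i)) = (\<Sum>i=1..n. g i)" for g :: "nat \<Rightarrow> 'a" and n
    by (simp add: sum.atLeast_Suc_atMost)
  have R: "R = 1 + F * R"
  proof (rule fps_ext)
    fix n
    show "R $ n = (1 + F * R) $ n"
    proof (cases "n = 0")
      case False
      have "(F * R) $ n = (\<Sum>i=0..n. if i = 0 then 0 else (of_nat i - 1) * e i * reduced_series (n - i))"
        unfolding fps_mult_nth by (rule sum.cong) (auto simp: F_def R_def)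
      with False show ?thesis unfolding first by (simp add: reduced_series_rec R_def)
    qed (simp add: R_def F_def reduced_series_0)
  qed
  have P: "P = 1 + U * R"
  proof (rule fps_ext)
    fix n
    show "P $ n = (1 + U * R) $ n"
    proof (cases "n = 0")
      case False
      have "(U * R) $ n = (\<Sum>i=0..n. if i = 0 then 0 else of_nat i * e i * reduced_series (n - i))"
        unfolding fps_mult_nth by (rule sum.cong) (auto simp: U_def R_def)
      with False show ?thesis unfolding first by (simp add: path_series_rec P_def)
    qed (simp add: P_def U_def path_series_0)
  qed
  have C: "C = fps_X * fps_deriv F * R"
  proof (rule fps_ext)
    fix n
    have "(fps_X * fps_deriv F) $ i = of_nat i * (of_nat i - 1) * e i" for i
      by (auto simp: F_def simp flip: of_nat_Suc)
    thus "C $ n = (fps_X * fps_deriv F * R) $ n"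
      unfolding fps_mult_nth[of "fps_X * fps_deriv F" R]
      by (simp add: C_def cycle_series_def R_def atLeast0AtMost)
  qed
  have FU: "fps_X * fps_deriv F = fps_X * fps_deriv U - U"
    by (rule fps_ext) (auto simp: F_def U_def algebra_simps simp flip: of_nat_Suc)
  have FU': "U - F = Abs_fps (\<lambda>k. if k = 0 then 0 else e k)"
    by (rule fps_ext) (auto simp: F_def U_def algebra_simps)
  have inv: "(1 - F) * R = 1" using R by (simp add: algebra_simps)
  have "fps_deriv R = fps_deriv F * R + F * fps_deriv R"
    by (subst R) (simp add: algebra_simps)
  hence "(1 - F) * fps_deriv R = fps_deriv F * R" by (simp add: algebra_simps)
  hence "((1 - F) * R) * fps_deriv R = fps_deriv F * R * R" by (metis mult.assoc mult.commute)
  hence R': "fps_deriv R = fps_deriv F * R * R" by (simp add: inv)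
  have CR: "C * R = fps_X * fps_deriv R"
    by (simp add: C R' algebra_simps)
  have "C * P = C + U * (C * R)" by (simp add: P algebra_simps)
  also have "\<dots> = (fps_X * fps_deriv U - U) * R + U * fps_X * fps_deriv R"
    unfolding CR by (simp add: C FU algebra_simps)
  also have "\<dots> = fps_X * fps_deriv P - P + 1"
    by (simp add: P algebra_simps)
  finally have CP: "C * P = fps_X * fps_deriv P - P + 1" .
  have PF: "P = 1 + (U - F) + F * P"
  proof -
    have "P - F * P = (1 - F) + U * ((1 - F) * R)" by (simp add: P algebra_simps)
    thus ?thesis unfolding inv by (simp add: algebra_simps)
  qed
  have X: "(fps_X * fps_deriv Q) $ n = of_nat n * Q $ n" for Q :: "'a fps" and n
    by (cases n) auto
  show "(\<Sum>j\<le>n. cycle_series j * reduced_series (n - j)) = of_nat n * reduced_series n"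
    using arg_cong[OF CR, of "\<lambda>f. f $ n"] unfolding X
    by (simp add: fps_mult_nth C_def R_def atLeast0AtMost)
  show "(\<Sum>j\<le>n. cycle_series j * path_series (n - j)) = (of_nat n - 1) * path_series n" if "1 \<le> n"
    using arg_cong[OF CP, of "\<lambda>f. f $ n"] that unfolding fps_add_nth fps_sub_nth X
    by (simp add: fps_mult_nth C_def P_def atLeast0AtMost algebra_simps)
  show "path_series n = e n + (\<Sum>k=1..n. (of_nat k - 1) * e k * path_series (n - k))" if "1 \<le> n"
  proof -
    have "(F * P) $ n = (\<Sum>i=0..n. if i = 0 then 0 else (of_nat i - 1) * e i * path_series (n - i))"
      unfolding fps_mult_nth by (rule sum.cong) (auto simp: F_def P_def)
    thus ?thesis using arg_cong[OF PF, of "\<lambda>f. f $ n"] that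
      unfolding first fps_add_nth FU' by (simp add: P_def)
  qed
qed

end

subsection \<open>Generating series of weighted sets\<close>

lift_definition weight_series :: "'x set \<Rightarrow> ('x \<Rightarrow> nat multiset) \<Rightarrow> (nat, rat) mpseries"
  is "\<lambda>A wt M. of_nat (card {x \<in> A. wt x = M})" .

text \<open>\<open>card\<close> of an infinite set is 0, so the sum and product rules for
  \<open>weight_series\<close> ask for finite fibres.\<close>

definition finite_fibres :: "'x set \<Rightarrow> ('x \<Rightarrow> nat multiset) \<Rightarrow> bool" where
  "finite_fibres A wt \<longleftrightarrow> (\<forall>M. finite {x \<in> A. wt x = M})"

lemma finite_fibres_subset: "finite_fibres A wt \<Longrightarrow> B \<subseteq> A \<Longrightarrow> finite_fibres B wt"
  unfolding finite_fibres_def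
proof
  fix M
  assume "\<forall>M. finite {x \<in> A. wt x = M}" "B \<subseteq> A"
  thus "finite {x \<in> B. wt x = M}"
    by (intro finite_subset[of "{x \<in> B. wt x = M}" "{x \<in> A. wt x = M}"]) auto
qed

lemma weight_series_bij_witness:
  assumes "\<And>x. x \<in> A \<Longrightarrow> i (f x) = x" "\<And>x. x \<in> A \<Longrightarrow> f x \<in> B"
    and "\<And>y. y \<in> B \<Longrightarrow> f (i y) = y" "\<And>y. y \<in> B \<Longrightarrow> i y \<in> A"
    and "\<And>x. x \<in> A \<Longrightarrow> wt' (f x) = wt x"
  shows "weight_series A wt = weight_series B wt'"
proof (rule mpseries_eqI)
  fix M
  have "bij_betw f {x \<in> A. wt x = M} {y \<in> B. wt' y = M}"
    using assms by (intro bij_betw_byWitness[where f' = i]) (auto, metis)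
  thus "mpcoeff (weight_series A wt) M = mpcoeff (weight_series B wt') M"
    by (simp add: weight_series.rep_eq bij_betw_same_card)
qed

lemma weight_series_split:
  assumes "finite_fibres A wt"
  shows "weight_series A wt = weight_series {x \<in> A. Q x} wt + weight_series {x \<in> A. \<not> Q x} wt"
proof (rule mpseries_eqI)
  fix M
  have fin: "finite {x \<in> {x \<in> A. P x}. wt x = M}" for P
    using finite_fibres_subset[OF assms, of "{x \<in> A. P x}"] by (auto simp: finite_fibres_def)
  have "{x \<in> A. wt x = M} = {x \<in> {x \<in> A. Q x}. wt x = M} \<union> {x \<in> {x \<in> A. \<not> Q x}. wt x = M}"
    by auto
  also have "card \<dots> = card {x \<in> {x \<in> A. Q x}. wt x = M} + card {x \<in> {x \<in> A. \<not> Q x}. wt x = M}"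
    by (rule card_Un_disjoint[OF fin fin]) auto
  finally show "mpcoeff (weight_series A wt) M =
      mpcoeff (weight_series {x \<in> A. Q x} wt + weight_series {x \<in> A. \<not> Q x} wt) M"
    by (simp add: weight_series.rep_eq plus_mpseries.rep_eq)
qed

text \<open>In a pair of weight \<open>M\<close> the first component takes some
  \<open>N \<subseteq># M\<close> and the second the rest \<open>M - N\<close>; these are the terms
  of the convolution product.\<close>

lemma
  assumes "finite_fibres A wt" "finite_fibres B wt'"
  shows weight_series_times: "weight_series (A \<times> B) (\<lambda>(x, y). wt x + wt' y) =
      weight_series A wt * weight_series B wt'"
    and finite_fibres_times: "finite_fibres (A \<times> B) (\<lambda>(x, y). wt x + wt' y)"
proof -
  let ?F = "\<lambda>M N. {x \<in> A. wt x = N} \<times> {y \<in> B. wt' y = M - N}"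
  have fib: "{z \<in> A \<times> B. (case z of (x, y) \<Rightarrow> wt x + wt' y) = M} = (\<Union>N\<in>{N. N \<subseteq># M}. ?F M N)" for M
    by auto
  have fin: "finite (?F M N)" for M N
    using assms by (simp add: finite_fibres_def)
  show "finite_fibres (A \<times> B) (\<lambda>(x, y). wt x + wt' y)"
    unfolding finite_fibres_def fib by (intro allI finite_UN_I finite_msubsets fin)
  show "weight_series (A \<times> B) (\<lambda>(x, y). wt x + wt' y) = weight_series A wt * weight_series B wt'"
  proof (rule mpseries_eqI)
    fix M
    have "card (\<Union>N\<in>{N. N \<subseteq># M}. ?F M N) = (\<Sum>N | N \<subseteq># M. card (?F M N))"
      by (rule card_UN_disjoint) (use fin finite_msubsets in auto)
    thus "mpcoeff (weight_series (A \<times> B) (\<lambda>(x, y). wt x + wt' y)) M =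
        mpcoeff (weight_series A wt * weight_series B wt') M"
      by (simp add: weight_series.rep_eq times_mpseries.rep_eq fib card_cartesian_product)
  qed
qed

text \<open>The second component is a mark without weight: \<open>k\<close> choices for every
  element and one more where \<open>Q\<close> holds.\<close>

lemma weight_series_Sigma:
  assumes "finite_fibres A wt" "\<And>x. x \<in> A \<Longrightarrow> finite (B x)"
    and "\<And>x. x \<in> A \<Longrightarrow> card (B x) = k + (if Q x then 1 else 0)"
  shows "weight_series (Sigma A B) (\<lambda>(x, y). wt x) =
      of_nat k * weight_series A wt + weight_series {x \<in> A. Q x} wt"
proof (rule mpseries_eqI)
  fix M
  let ?F = "{x \<in> A. wt x = M}"
  have fin: "finite ?F" using assms(1) by (simp add: finite_fibres_def)
  have of_nat_times: "mpcoeff (of_nat k * f) M = of_nat k * mpcoeff f M" for f :: "(nat, rat) mpseries" and k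
    by (induction k) (simp_all add: algebra_simps plus_mpseries.rep_eq zero_mpseries.rep_eq)
  have "{z \<in> Sigma A B. (case z of (x, y) \<Rightarrow> wt x) = M} = Sigma ?F B" by auto
  hence "card {z \<in> Sigma A B. (case z of (x, y) \<Rightarrow> wt x) = M} = (\<Sum>x\<in>?F. k + (if Q x then 1 else 0))"
    using fin assms by (simp add: card_SigmaI)
  also have "\<dots> = k * card ?F + card {x \<in> {x \<in> A. Q x}. wt x = M}"
    using fin unfolding sum.distrib
    by (simp add: sum.If_cases Int_def conj_ac)
  finally show "mpcoeff (weight_series (Sigma A B) (\<lambda>(x, y). wt x)) M =
      mpcoeff (of_nat k * weight_series A wt + weight_series {x \<in> A. Q x} wt) M"
    by (simp add: weight_series.rep_eq plus_mpseries.rep_eq of_nat_times)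
qed

subsection \<open>Paths\<close>

definition path_words :: "nat \<Rightarrow> nat list set" where
  "path_words n = {w. length w = n \<and> distinct_adj w}"

definition path_sym :: "nat \<Rightarrow> (nat, rat) mpseries" where
  "path_sym n = weight_series (path_words n) mset"

lemma finite_fibres_mset: "finite_fibres A mset"
  unfolding finite_fibres_def
proof
  fix M :: "nat multiset"
  obtain xs where "M = mset xs" by (metis ex_mset)
  hence "finite {x. mset x = M}" using mset_eq_finite[of xs] by simp
  thus "finite {x \<in> A. mset x = M}" by (rule rev_finite_subset) auto
qed

definition k_sets :: "nat \<Rightarrow> nat set set" where
  "k_sets k = {S. finite S \<and> card S = k}"

lemma
  shows elem_sym_eq_weight_series: "elem_sym k = weight_series (k_sets k) mset_set"
    and finite_fibres_k_sets: "finite_fibres (k_sets k) mset_set"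
proof -
  have fib: "{S \<in> k_sets k. mset_set S = M} =
      (if size M = k \<and> (\<forall>x. count M x \<le> 1) then {set_mset M} else {})" for M
  proof (cases "size M = k \<and> (\<forall>x. count M x \<le> 1)")
    case True
    have "mset_set (set_mset M) = M"
    proof (rule multiset_eqI)
      fix x
      have "count M x \<le> 1" using True by blast
      thus "count (mset_set (set_mset M)) x = count M x"
        using count_eq_zero_iff[of M x] by (auto simp: count_mset_set' le_Suc_eq)
    qed
    note M = this
    have "card (set_mset M) = k" using True M by (metis size_mset_set)
    hence "set_mset M \<in> k_sets k" by (simp add: k_sets_def)
    moreover have "S = set_mset M" if "S \<in> k_sets k" "mset_set S = M" for S
      using that by (metis (no_types, lifting) finite_set_mset_mset_set k_sets_def mem_Collect_eq)
    ultimately have "{S \<in> k_sets k. mset_set S = M} = {set_mset M}"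
      using M by blast
    thus ?thesis using True by simp
  next
    case False
    have "mset_set S \<noteq> M" if "S \<in> k_sets k" for S
      using that False by (auto simp: k_sets_def count_mset_set' split: if_splits)
    hence "{S \<in> k_sets k. mset_set S = M} = {}" by blast
    thus ?thesis unfolding if_not_P[OF False] .
  qed
  show "finite_fibres (k_sets k) mset_set"
    unfolding finite_fibres_def fib by simp
  show "elem_sym k = weight_series (k_sets k) mset_set"
    by (rule mpseries_eqI) (simp add: elem_sym.rep_eq weight_series.rep_eq fib)
qed

text \<open>These pairs interpolate between words (\<open>k = 0\<close>) and sets
  (\<open>l = 0\<close>), that is, between \<open>path_sym\<close> and
  \<open>elem_sym\<close>.\<close>

definition avoiding_pairs :: "nat \<Rightarrow> nat \<Rightarrow> (nat set \<times> nat list) set" where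
  "avoiding_pairs k l = {(S, w) \<in> k_sets k \<times> path_words l. w = [] \<or> hd w \<notin> S}"

abbreviation pair_weight :: "nat set \<times> nat list \<Rightarrow> nat multiset" where
  "pair_weight \<equiv> \<lambda>(S, w). mset_set S + mset w"

text \<open>Moving the first letter of the word into the set turns a pair of sizes \<open>k, l + 1\<close> into a pair
  of sizes \<open>k + 1, l\<close> with a marked element of the set that may precede the word.\<close>

lemma avoiding_pairs_step:
  "weight_series (avoiding_pairs k (Suc l)) pair_weight =
     of_nat k * (elem_sym (Suc k) * path_sym l) + weight_series (avoiding_pairs (Suc k) l) pair_weight"
proof -
  define A where "A = k_sets (Suc k) \<times> path_words l"
  define B where "B = (\<lambda>(S :: nat set, w). {s \<in> S. w = [] \<or> s \<noteq> hd w})"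
  have fin: "finite_fibres A pair_weight"
    unfolding A_def by (intro finite_fibres_times finite_fibres_k_sets finite_fibres_mset)
  have "weight_series (avoiding_pairs k (Suc l)) pair_weight =
      weight_series (Sigma A B) (\<lambda>(x, y). pair_weight x)"
  proof (rule weight_series_bij_witness
      [where f = "\<lambda>(S, w). ((insert (hd w) S, tl w), hd w)" and i = "\<lambda>((S, w), s). (S - {s}, s # w)"],
      goal_cases)
    case (1 x)
    then obtain S s w where "x = (S, s # w)" "s \<notin> S"
      by (cases x; cases "snd x") (auto simp: avoiding_pairs_def path_words_def)
    thus ?case by simp
  next
    case (2 x)
    then obtain S s w where "x = (S, s # w)" "s \<notin> S" "S \<in> k_sets k" "s # w \<in> path_words (Suc l)"
      by (cases x; cases "snd x") (auto simp: avoiding_pairs_def path_words_def)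
    thus ?case by (auto simp: A_def B_def k_sets_def path_words_def distinct_adj_Cons)
  next
    case (3 y)
    thus ?case by (auto simp: A_def B_def)
  next
    case (4 y)
    thus ?case
      by (auto simp: A_def B_def k_sets_def path_words_def distinct_adj_Cons avoiding_pairs_def)
  next
    case (5 x)
    then obtain S s w where "x = (S, s # w)" "s \<notin> S" "S \<in> k_sets k"
      by (cases x; cases "snd x") (auto simp: avoiding_pairs_def path_words_def)
    thus ?case by (simp add: k_sets_def)
  qed
  also have "\<dots> = of_nat k * weight_series A pair_weight +
      weight_series {x \<in> A. (\<lambda>(S, w). w = [] \<or> hd w \<notin> S) x} pair_weight"
  proof (rule weight_series_Sigma[OF fin])
    fix x assume "x \<in> A"
    then obtain S w where x: "x = (S, w)" "finite S" "card S = Suc k"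
      by (auto simp: A_def k_sets_def)
    show "finite (B x)" using x by (simp add: B_def)
    \<comment> \<open>Only the first letter of \<open>w\<close> is forbidden as a mark; it costs one
      choice when it lies in \<open>S\<close>.\<close>
    have "B x = (if w = [] \<or> hd w \<notin> S then S else S - {hd w})"
      using x by (auto simp: B_def)
    thus "card (B x) = k + (if (\<lambda>(S, w). w = [] \<or> hd w \<notin> S) x then 1 else 0)"
      using x by (auto simp: card_Diff_singleton)
  qed
  also have "{x \<in> A. (\<lambda>(S, w). w = [] \<or> hd w \<notin> S) x} = avoiding_pairs (Suc k) l"
    by (auto simp: A_def avoiding_pairs_def)
  also have "weight_series A pair_weight = elem_sym (Suc k) * path_sym l"
    unfolding A_def elem_sym_eq_weight_series path_sym_def
    by (intro weight_series_times finite_fibres_k_sets finite_fibres_mset)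
  finally show ?thesis .
qed

text \<open>Starting with the empty set and moving letters into it until the word is empty yields
  the recursion of \<open>path_series_last\<close>.\<close>

lemma path_sym_eq: "path_sym n = path_series elem_sym n"
proof (induction n rule: less_induct)
  case (less n)
  have G: "weight_series (avoiding_pairs k l) pair_weight =
      (\<Sum>i<l. of_nat (k + i) * elem_sym (Suc (k + i)) * path_sym (l - Suc i)) + elem_sym (k + l)" for k l
  proof (induction l arbitrary: k)
    case 0
    have "weight_series (avoiding_pairs k 0) pair_weight = weight_series (k_sets k) mset_set"
      by (rule weight_series_bij_witness[where f = fst and i = "\<lambda>S. (S, [])"])
        (auto simp: avoiding_pairs_def path_words_def)
    thus ?case by (simp add: elem_sym_eq_weight_series)
  next
    case (Suc l)
    show ?case
      unfolding avoiding_pairs_step Suc.IH sum.lessThan_Suc_shift by (simp add: algebra_simps)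
  qed
  have "path_sym n = weight_series (avoiding_pairs 0 n) pair_weight"
    unfolding path_sym_def
    by (rule weight_series_bij_witness[where f = "\<lambda>w. ({}, w)" and i = snd])
      (auto simp: avoiding_pairs_def k_sets_def)
  also have "\<dots> = (\<Sum>i<n. of_nat i * elem_sym (Suc i) * path_series elem_sym (n - Suc i)) + elem_sym n"
    unfolding G by (simp add: less.IH)
  finally have rec: "path_sym n = \<dots>" .
  show ?case
  proof (cases "n = 0")
    case True
    have "mpcoeff (elem_sym 0) M = mpcoeff 1 M" for M
      by (auto simp: elem_sym.rep_eq one_mpseries.rep_eq)
    hence "elem_sym 0 = 1" by (rule mpseries_eqI)
    thus ?thesis using True rec by (simp add: path_series_0)
  next
    case False
    have "(\<Sum>k=1..n. (of_nat k - 1) * elem_sym k * path_series elem_sym (n - k)) =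
        (\<Sum>i<n. of_nat i * elem_sym (Suc i) * path_series elem_sym (n - Suc i))"
      by (rule sum.reindex_bij_witness[where i = Suc and j = "\<lambda>k. k - 1"]) auto
    thus ?thesis using False rec path_series_last[of n elem_sym] by simp
  qed
qed

subsection \<open>Stars and hats\<close>

text \<open>A star is a triple of words glued to a common centre \<open>c\<close>. The series of the spider with
  legs \<open>x, y, z\<close> counts the centre once; contracting an edge of a spider counts it twice.\<close>

definition stars :: "nat \<Rightarrow> nat \<Rightarrow> nat \<Rightarrow> (nat \<times> nat list \<times> nat list \<times> nat list) set" where
  "stars p q r = {(c, x, y, z). length x = p \<and> length y = q \<and> length z = r \<and>
     distinct_adj (c # x) \<and> distinct_adj (c # y) \<and> distinct_adj (c # z)}"

definition spider_sym :: "nat \<Rightarrow> nat \<Rightarrow> nat \<Rightarrow> (nat, rat) mpseries" where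
  "spider_sym p q r =
     weight_series (stars p q r) (\<lambda>(c, x, y, z). {#c#} + mset x + mset y + mset z)"

definition contracted_sym :: "nat \<Rightarrow> nat \<Rightarrow> nat \<Rightarrow> (nat, rat) mpseries" where
  "contracted_sym p q r =
     weight_series (stars p q r) (\<lambda>(c, x, y, z). {#c, c#} + mset x + mset y + mset z)"

lemma spider_sym_swap: "spider_sym p q r = spider_sym q p r"
  unfolding spider_sym_def
  by (rule weight_series_bij_witness[where f = "\<lambda>(c, x, y, z). (c, y, x, z)"
        and i = "\<lambda>(c, x, y, z). (c, y, x, z)"]) (auto simp: stars_def)

lemma contracted_sym_swap: "contracted_sym p q r = contracted_sym q p r"
  unfolding contracted_sym_def
  by (rule weight_series_bij_witness[where f = "\<lambda>(c, x, y, z). (c, y, x, z)"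
        and i = "\<lambda>(c, x, y, z). (c, y, x, z)"]) (auto simp: stars_def)

lemma contracted_sym_swap': "contracted_sym p q r = contracted_sym p r q"
  unfolding contracted_sym_def
  by (rule weight_series_bij_witness[where f = "\<lambda>(c, x, y, z). (c, x, z, y)"
        and i = "\<lambda>(c, x, y, z). (c, x, z, y)"]) (auto simp: stars_def)

lemma distinct_adj_glue:
  "distinct_adj (rev y @ c # z) \<longleftrightarrow> distinct_adj (c # y) \<and> distinct_adj (c # z)"
  by (auto simp: distinct_adj_append_iff distinct_adj_Cons[of c y] last_rev)

lemma path_words_split:
  assumes "w \<in> path_words (q + 1 + r)"
  obtains y c z where "w = rev y @ c # z" "length y = q" "length z = r"
    "distinct_adj (c # y)" "distinct_adj (c # z)"
proof -
  have "w = rev (rev (take q w)) @ w ! q # drop (Suc q) w"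
    using assms by (simp add: path_words_def id_take_nth_drop)
  moreover from this have "distinct_adj (w ! q # rev (take q w))" "distinct_adj (w ! q # drop (Suc q) w)"
    using assms distinct_adj_glue[of "rev (take q w)" "w ! q" "drop (Suc q) w"]
    by (auto simp: path_words_def)
  ultimately show ?thesis
    using assms by (intro that[of "rev (take q w)" "w ! q" "drop (Suc q) w"]) (auto simp: path_words_def)
qed

abbreviation word_pairs :: "nat \<Rightarrow> nat \<Rightarrow> (nat list \<times> nat list) set" where
  "word_pairs k l \<equiv> path_words k \<times> path_words l"

abbreviation words_weight :: "nat list \<times> nat list \<Rightarrow> nat multiset" where
  "words_weight \<equiv> \<lambda>(x, y). mset x + mset y"

lemma finite_fibres_word_pairs: "A \<subseteq> word_pairs k l \<Longrightarrow> finite_fibres A words_weight"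
  by (rule finite_fibres_subset[OF finite_fibres_times[OF finite_fibres_mset finite_fibres_mset]])

lemma path_sym_times: "path_sym k * path_sym l = weight_series (word_pairs k l) words_weight"
  unfolding path_sym_def by (simp add: weight_series_times finite_fibres_mset)

text \<open>The doubled centre is split: one copy heads the word \<open>x\<close>, the other sits at
  position \<open>q\<close> of the path through the two remaining legs.\<close>

lemma contracted_sym_eq_pairs:
  "contracted_sym p q r =
     weight_series {(x, y) \<in> word_pairs (p + 1) (q + 1 + r). hd x = y ! q} words_weight"
  unfolding contracted_sym_def
proof (rule weight_series_bij_witness[where f = "\<lambda>(c, x, y, z). (c # x, rev y @ c # z)"
      and i = "\<lambda>(x, y). (hd x, tl x, rev (take q y), drop (Suc q) y)"], goal_cases)
  case (3 w)
  then obtain x v where w: "w = (x, v)" "x \<in> path_words (p + 1)" "v \<in> path_words (q + 1 + r)"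
    "hd x = v ! q" by auto
  moreover obtain y c z where "v = rev y @ c # z" "length y = q" using w(3) by (rule path_words_split)
  ultimately show ?case by (cases x) (auto simp: path_words_def nth_append)
next
  case (4 w)
  then obtain x v where w: "w = (x, v)" "x \<in> path_words (p + 1)" "v \<in> path_words (q + 1 + r)"
    "hd x = v ! q" by auto
  moreover obtain y c z where "v = rev y @ c # z" "length y = q" "length z = r"
    "distinct_adj (c # y)" "distinct_adj (c # z)" using w(3) by (rule path_words_split)
  ultimately show ?case by (cases x) (auto simp: path_words_def nth_append stars_def)
qed (auto simp: stars_def path_words_def distinct_adj_glue nth_append)

text \<open>Detaching a nonempty leg leaves a path with the centre at position \<open>q\<close>, and
  the condition that the first letter of the leg differs from it.\<close>

lemma spider_sym_eq_pairs:
  "spider_sym (p + 1) q r =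
     weight_series {(x, y) \<in> word_pairs (p + 1) (q + 1 + r). hd x \<noteq> y ! q} words_weight"
  unfolding spider_sym_def
proof (rule weight_series_bij_witness[where f = "\<lambda>(c, x, y, z). (x, rev y @ c # z)"
      and i = "\<lambda>(x, y). (y ! q, x, rev (take q y), drop (Suc q) y)"], goal_cases)
  case (2 w)
  then obtain c x y z where "w = (c, x, y, z)" by (cases w)
  with 2 show ?case
    by (cases x) (auto simp: stars_def path_words_def distinct_adj_glue nth_append)
next
  case (3 w)
  then obtain x v where w: "w = (x, v)" "x \<in> path_words (p + 1)" "v \<in> path_words (q + 1 + r)"
    "hd x \<noteq> v ! q" by auto
  moreover obtain y c z where "v = rev y @ c # z" "length y = q" using w(3) by (rule path_words_split)
  ultimately show ?case by (auto simp: path_words_def nth_append)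
next
  case (4 w)
  then obtain x v where w: "w = (x, v)" "x \<in> path_words (p + 1)" "v \<in> path_words (q + 1 + r)"
    "hd x \<noteq> v ! q" by auto
  moreover obtain y c z where "v = rev y @ c # z" "length y = q" "length z = r"
    "distinct_adj (c # y)" "distinct_adj (c # z)" using w(3) by (rule path_words_split)
  ultimately show ?case by (cases x) (auto simp: path_words_def nth_append stars_def)
qed (auto simp: stars_def nth_append)

text \<open>Deletion and contraction at the edge joining the first leg to the centre: without that
  edge the spider is a disjoint union of two paths.\<close>

lemma contracted_plus_spider:
  "contracted_sym p q r + spider_sym (p + 1) q r = path_sym (p + 1) * path_sym (q + 1 + r)"
proof -
  have "path_sym (p + 1) * path_sym (q + 1 + r) =
      weight_series {w \<in> word_pairs (p + 1) (q + 1 + r). (\<lambda>(x, y). hd x = y ! q) w} words_weight +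
      weight_series {w \<in> word_pairs (p + 1) (q + 1 + r). \<not> (\<lambda>(x, y). hd x = y ! q) w} words_weight"
    unfolding path_sym_times by (rule weight_series_split[OF finite_fibres_word_pairs[OF order_refl]])
  also have "{w \<in> word_pairs (p + 1) (q + 1 + r). (\<lambda>(x, y). hd x = y ! q) w} =
      {(x, y) \<in> word_pairs (p + 1) (q + 1 + r). hd x = y ! q}" by auto
  also have "{w \<in> word_pairs (p + 1) (q + 1 + r). \<not> (\<lambda>(x, y). hd x = y ! q) w} =
      {(x, y) \<in> word_pairs (p + 1) (q + 1 + r). hd x \<noteq> y ! q}" by auto
  finally show ?thesis by (simp only: contracted_sym_eq_pairs spider_sym_eq_pairs)
qed

lemma spider_sym_0: "spider_sym 0 q r = path_sym (q + 1 + r)"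
  unfolding spider_sym_def path_sym_def
proof (rule weight_series_bij_witness[where f = "\<lambda>(c, x, y, z). rev y @ c # z"
      and i = "\<lambda>w. (w ! q, [], rev (take q w), drop (Suc q) w)"], goal_cases)
  case (3 w)
  then obtain y c z where "w = rev y @ c # z" "length y = q" by (rule path_words_split)
  thus ?case by (simp add: nth_append)
next
  case (4 w)
  then obtain y c z where "w = rev y @ c # z" "length y = q" "length z = r"
    "distinct_adj (c # y)" "distinct_adj (c # z)" by (rule path_words_split)
  thus ?case by (simp add: nth_append stars_def)
qed (auto simp: stars_def path_words_def distinct_adj_glue nth_append)

lemma contracted_sym_0: "contracted_sym p 0 r = path_sym (p + 1) * path_sym (r + 1) - path_sym (p + r + 2)"
  using contracted_plus_spider[of p 0 r] spider_sym_swap[of "p + 1" 0 r] spider_sym_0[of "p + 1" r]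
  by (simp add: algebra_simps)

text \<open>The spider with legs \<open>p + 1\<close>, \<open>q + 1\<close> and \<open>r\<close> can
  be cut at either of its first two legs; comparing the two expressions eliminates it.\<close>

lemma contracted_sym_Suc:
  "contracted_sym p (Suc q) r = contracted_sym (Suc p) q r +
     path_sym (p + 1) * path_sym (q + r + 2) - path_sym (q + 1) * path_sym (p + r + 2)"
proof -
  have "contracted_sym p (Suc q) r = path_sym (p + 1) * path_sym (q + r + 2) - spider_sym (p + 1) (q + 1) r"
    using contracted_plus_spider[of p "Suc q" r] by (simp add: eq_diff_eq)
  moreover have "contracted_sym (Suc p) q r =
      path_sym (q + 1) * path_sym (p + r + 2) - spider_sym (p + 1) (q + 1) r"
    using contracted_plus_spider[of q "Suc p" r] contracted_sym_swap[of q "Suc p" r]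
      spider_sym_swap[of "p + 1" "q + 1" r]
    by (simp add: eq_diff_eq)
  ultimately show ?thesis by simp
qed

text \<open>The second leg is moved onto the first one vertex at a time, down to
  \<open>q = 0\<close>, where \<open>contracted_sym_0\<close> applies.\<close>

lemma contracted_sym_eq:
  "contracted_sym p q r = (\<Sum>s=1..q + 1. path_sym (r + s) * path_sym (p + q + 2 - s))
     - (\<Sum>i=1..q. path_sym i * path_sym (p + q + r + 2 - i)) - path_sym (p + q + r + 2)"
proof (induction q arbitrary: p)
  case 0
  show ?case by (simp add: contracted_sym_0 algebra_simps)
next
  case (Suc q)
  show ?case unfolding contracted_sym_Suc Suc.IH
    by (simp add: algebra_simps)
qed

section \<open>Colorings of the hat as words, and triple deletion\<close>

definition hat_words :: "nat \<Rightarrow> nat \<Rightarrow> nat \<Rightarrow> nat list set" where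
  "hat_words a m b = {w \<in> path_words (a + m + b). w ! a \<noteq> w ! (a + m - 1)}"

definition hat_sym :: "nat \<Rightarrow> nat \<Rightarrow> nat \<Rightarrow> (nat, rat) mpseries" where
  "hat_sym a m b = weight_series (hat_words a m b) mset"

text \<open>At \<open>m = 1\<close> the extra edge is a loop and admits no proper coloring; the
  recursions below stop here.\<close>

lemma hat_sym_1: "hat_sym a 1 b = 0"
  by (rule mpseries_eqI) (simp add: hat_sym_def hat_words_def weight_series.rep_eq zero_mpseries.rep_eq)

lemma hat_sym_rev:
  assumes "1 \<le> m"
  shows "hat_sym a m b = hat_sym b m a"
  unfolding hat_sym_def
proof (rule weight_series_bij_witness[where f = rev and i = rev], goal_cases)
  case (2 w)
  with assms show ?case by (auto simp: hat_words_def path_words_def rev_nth algebra_simps)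
next
  case (4 w)
  with assms show ?case by (auto simp: hat_words_def path_words_def rev_nth algebra_simps)
qed auto

text \<open>The word is cut after position \<open>k\<close>, and the left piece is reversed so that
  the letters on both sides of the cut become heads.\<close>

lemma weight_series_glued_words:
  "weight_series {w \<in> path_words (k + 1 + l). Q w} mset =
     weight_series {(x, y) \<in> word_pairs (k + 1) l. (y = [] \<or> hd x \<noteq> hd y) \<and> Q (rev x @ y)} words_weight"
proof (rule weight_series_bij_witness[where f = "\<lambda>w. (rev (take (k + 1) w), drop (k + 1) w)"
      and i = "\<lambda>(x, y). rev x @ y"], goal_cases)
  case (2 w)
  hence "length w = k + 1 + l" "distinct_adj (take (k + 1) w @ drop (k + 1) w)" "Q w"
    by (auto simp: path_words_def)
  thus ?case unfolding distinct_adj_append_iff by (auto simp: path_words_def hd_rev)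
next
  case (4 w)
  thus ?case by (auto simp: path_words_def distinct_adj_append_iff last_rev)
next
  case (5 w)
  have "mset (take (k + 1) w) + mset (drop (k + 1) w) = mset w"
    by (simp only: mset_append[symmetric] append_take_drop_id)
  thus ?case by simp
qed (auto simp: path_words_def)

text \<open>Triple deletion: both sides count the pairs of words with different heads together with the
  pairs in which both heads agree with the letter \<open>y ! q\<close>.\<close>

lemma hat_sym_step:
  "hat_sym a (q + 2) b + contracted_sym a q b =
     hat_sym (a + 1) (q + 1) b + path_sym (a + 1) * (path_sym (q + 1 + b) - hat_sym 0 (q + 1) b)"
proof -
  let ?W = "word_pairs (a + 1) (q + 1 + b)"
  have hd0: "hd x = x ! 0" if "length x = Suc k" for x :: "nat list" and k
    using that by (cases x) auto
  \<comment> \<open>\<open>s\<close>, \<open>t\<close>, \<open>u\<close> are the colours of the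
    vertices \<open>a + 1\<close>, \<open>a + 2\<close> and \<open>a + q + 2\<close> once the edge
    between the first two is removed. All four terms of the claim become conditions on these
    colours.\<close>
  define w where "w = (\<lambda>Q. weight_series {(x, y) \<in> ?W. Q (hd x) (hd y) (y ! q)} words_weight)"
  have w_split: "w Q = w (\<lambda>s t u. Q s t u \<and> Q' s t u) + w (\<lambda>s t u. Q s t u \<and> \<not> Q' s t u)" for Q Q'
    unfolding w_def
    by (subst weight_series_split[OF finite_fibres_word_pairs, of _ "a + 1" "q + 1 + b"
          "\<lambda>(x, y). Q' (hd x) (hd y) (y ! q)"])
      (auto intro!: arg_cong2[where f = "(+)"] arg_cong2[where f = weight_series])
  have H1: "hat_sym a (q + 2) b = w (\<lambda>s t u. s \<noteq> t \<and> u \<noteq> s)"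
  proof -
    have "hat_sym a (q + 2) b = weight_series {w \<in> path_words (a + 1 + (q + 1 + b)).
        w ! a \<noteq> w ! (a + 1 + q)} mset"
      unfolding hat_sym_def hat_words_def by (simp add: algebra_simps)
    also have "\<dots> = w (\<lambda>s t u. s \<noteq> t \<and> u \<noteq> s)"
      unfolding weight_series_glued_words w_def
      by (intro arg_cong2[where f = weight_series] refl)
        (auto simp: path_words_def nth_append rev_nth hd0)
    finally show ?thesis .
  qed
  have H2: "hat_sym (a + 1) (q + 1) b = w (\<lambda>s t u. s \<noteq> t \<and> u \<noteq> t)"
  proof -
    have "hat_sym (a + 1) (q + 1) b = weight_series {w \<in> path_words (a + 1 + (q + 1 + b)).
        w ! (a + 1) \<noteq> w ! (a + 1 + q)} mset"
      unfolding hat_sym_def hat_words_def by (simp add: algebra_simps)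
    also have "\<dots> = w (\<lambda>s t u. s \<noteq> t \<and> u \<noteq> t)"
      unfolding weight_series_glued_words w_def
      by (intro arg_cong2[where f = weight_series] refl)
        (auto simp: path_words_def nth_append rev_nth hd0)
    finally show ?thesis .
  qed
  have V: "contracted_sym a q b = w (\<lambda>s t u. s = u)"
    unfolding contracted_sym_eq_pairs w_def ..
  \<comment> \<open>\<open>t = u\<close> does not involve \<open>x\<close>, so the path on
    \<open>a + 1\<close> vertices splits off; the words with equal letters at \<open>0\<close> and
    \<open>q\<close> are the complement of the hat words.\<close>
  have T: "path_sym (a + 1) * (path_sym (q + 1 + b) - hat_sym 0 (q + 1) b) = w (\<lambda>s t u. t = u)"
  proof -
    have "path_sym (q + 1 + b) =
        weight_series {w \<in> path_words (q + 1 + b). w ! 0 = w ! q} mset + hat_sym 0 (q + 1) b"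
      unfolding path_sym_def hat_sym_def hat_words_def
      by (subst weight_series_split[OF finite_fibres_mset, of _ "\<lambda>w. w ! 0 = w ! q"]) simp
    hence "path_sym (a + 1) * (path_sym (q + 1 + b) - hat_sym 0 (q + 1) b) =
        weight_series (path_words (a + 1) \<times> {w \<in> path_words (q + 1 + b). w ! 0 = w ! q}) words_weight"
      by (simp add: path_sym_def weight_series_times finite_fibres_mset)
    also have "\<dots> = w (\<lambda>s t u. t = u)"
      unfolding w_def
      by (intro arg_cong2[where f = weight_series] refl) (auto simp: path_words_def hd0)
    finally show ?thesis .
  qed
  have "w (\<lambda>s t u. s \<noteq> t \<and> u \<noteq> s) + w (\<lambda>s t u. s = u) = w (\<lambda>s t u. s \<noteq> t) + w (\<lambda>s t u. s = t \<and> s = u)"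
    using w_split[of "\<lambda>s t u. s \<noteq> t" "\<lambda>s t u. u \<noteq> s"] w_split[of "\<lambda>s t u. s = u" "\<lambda>s t u. s = t"]
    by (simp add: algebra_simps conj_commute eq_commute)
  moreover have "w (\<lambda>s t u. s \<noteq> t \<and> u \<noteq> t) + w (\<lambda>s t u. t = u) =
      w (\<lambda>s t u. s \<noteq> t) + w (\<lambda>s t u. s = t \<and> s = u)"
  proof -
    have "w (\<lambda>s t u. t = u \<and> s = t) = w (\<lambda>s t u. s = t \<and> s = u)"
      by (rule arg_cong[where f = w]) auto
    thus ?thesis
      using w_split[of "\<lambda>s t u. s \<noteq> t" "\<lambda>s t u. u \<noteq> t"] w_split[of "\<lambda>s t u. t = u" "\<lambda>s t u. s = t"]
      by (simp add: algebra_simps conj_commute eq_commute)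
  qed
  ultimately show ?thesis unfolding H1 H2 V T by simp
qed

lemma chromatic_sym_hat_graph:
  assumes "2 \<le> m"
  shows "chromatic_sym (hat_graph a m b) = hat_sym a m b"
proof -
  define n where "n = a + m + b"
  have proper: "proper_colorings (hat_graph a m b) = {\<kappa> \<in> {1..n} \<rightarrow>\<^sub>E UNIV.
      (\<forall>i. Suc i < n \<longrightarrow> \<kappa> (Suc i) \<noteq> \<kappa> (Suc (Suc i))) \<and> \<kappa> (a + 1) \<noteq> \<kappa> (a + m)}" (is "?L = ?R")
  proof
    show "?L \<subseteq> ?R"
    proof
      fix \<kappa> assume \<kappa>: "\<kappa> \<in> ?L"
      have "\<kappa> (Suc i) \<noteq> \<kappa> (Suc (Suc i))" if "Suc i < n" for i
      proof -
        have "{Suc i, Suc (Suc i)} \<in> snd (hat_graph a m b)"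
          using that by (auto simp: hat_graph_def n_def)
        thus ?thesis using \<kappa> by (auto simp: proper_colorings_def)
      qed
      moreover have "{a + 1, a + m} \<in> snd (hat_graph a m b)" by (simp add: hat_graph_def)
      ultimately show "\<kappa> \<in> ?R"
        using \<kappa> by (auto simp: proper_colorings_def hat_graph_def n_def)
    qed
    show "?R \<subseteq> ?L"
    proof
      fix \<kappa> assume \<kappa>: "\<kappa> \<in> ?R"
      have "\<kappa> i \<noteq> \<kappa> (i + 1)" if "1 \<le> i" "i < n" for i
        using \<kappa> that by (cases i) auto
      with \<kappa> show "\<kappa> \<in> ?L"
        unfolding proper_colorings_def hat_graph_def n_def[symmetric]
        by (auto simp: doubleton_eq_iff n_def) metis+
    qed
  qed
  have "chromatic_sym (hat_graph a m b) = weight_series (proper_colorings (hat_graph a m b))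
      (\<lambda>\<kappa>. image_mset \<kappa> (mset_set {1..n}))"
    by (rule mpseries_eqI) (simp add: chromatic_sym.rep_eq weight_series.rep_eq hat_graph_def n_def)
  also have "\<dots> = hat_sym a m b"
    unfolding hat_sym_def
  proof (rule weight_series_bij_witness[where f = "\<lambda>\<kappa>. map \<kappa> [1..<n + 1]"
        and i = "\<lambda>w. \<lambda>i\<in>{1..n}. w ! (i - 1)"], goal_cases)
    case (1 \<kappa>)
    thus ?case unfolding proper
      by (auto simp: PiE_def extensional_def fun_eq_iff simp del: upt_Suc)
  next
    case (2 \<kappa>)
    thus ?case using assms unfolding proper
      by (auto simp: hat_words_def path_words_def distinct_adj_conv_nth n_def simp del: upt_Suc)
  next
    case (3 w)
    thus ?case
      by (auto intro!: nth_equalityI simp: hat_words_def path_words_def n_def simp del: upt_Suc)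
  next
    case (4 w)
    thus ?case using assms unfolding proper
      by (auto simp: hat_words_def path_words_def distinct_adj_conv_nth n_def)
  next
    case (5 \<kappa>)
    have "mset [1..<n + 1] = mset_set {1..n}"
      unfolding mset_upt by (rule arg_cong[where f = mset_set]) auto
    thus ?case by (simp del: upt_Suc)
  qed
  finally show ?thesis .
qed

subsection \<open>The hat in terms of paths\<close>

lemma cycle_series_0: "cycle_series e 0 = 0"
  by (simp add: cycle_series_def)

text \<open>With \<open>b = 0\<close> one leg of the contracted star is empty, so triple deletion
  involves only paths, tadpoles and a cycle.\<close>

lemma tadpole_sym_step:
  "hat_sym a (q + 2) 0 = hat_sym (a + 1) (q + 1) 0 + path_sym (a + q + 2) - path_sym (a + 1) * hat_sym 0 (q + 1) 0"
proof -
  have V: "contracted_sym a q 0 = path_sym (a + 1) * path_sym (q + 1) - path_sym (a + q + 2)"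
    using contracted_sym_swap'[of a q 0] contracted_sym_0[of a q] by simp
  have H: "hat_sym a (q + 2) 0 = hat_sym (a + 1) (q + 1) 0 +
      path_sym (a + 1) * (path_sym (q + 1) - hat_sym 0 (q + 1) 0) - contracted_sym a q 0"
    using hat_sym_step[of a q 0] by (simp add: eq_diff_eq)
  show ?thesis unfolding H V by (simp add: algebra_simps)
qed

text \<open>Each step shortens the cycle by one vertex and lengthens the tail by one, until the
  cycle is a loop. The factor \<open>hat_sym 0 j 0\<close> belongs to the cycle on \<open>j\<close>
  vertices.\<close>

lemma tadpole_sym_rec:
  "hat_sym a (q + 1) 0 = of_nat q * path_sym (a + q + 1) -
     (\<Sum>j=1..q. hat_sym 0 j 0 * path_sym (a + q + 1 - j))"
proof (induction q arbitrary: a)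
  case 0
  show ?case using hat_sym_1[of a 0] by simp
next
  case (Suc q)
  have step: "hat_sym a (Suc q + 1) 0 =
      hat_sym (a + 1) (q + 1) 0 + path_sym (a + q + 2) - path_sym (a + 1) * hat_sym 0 (q + 1) 0"
    using tadpole_sym_step[of a q] by simp
  show ?case unfolding step Suc.IH[of "a + 1"] by (simp add: algebra_simps)
qed

text \<open>Without a tail, \<open>tadpole_sym_rec\<close> is \<open>cycle_path_convolution\<close>
  solved for its last term, so both sides obey one recursion.\<close>

lemma cycle_sym_eq:
  assumes "1 \<le> n"
  shows "hat_sym 0 n 0 = cycle_series elem_sym n"
  using assms
proof (induction n rule: less_induct)
  case (less n)
  then obtain q where n: "n = q + 1" by (metis le_add_diff_inverse2)
  have "(\<Sum>j\<le>n. cycle_series elem_sym j * path_series elem_sym (n - j)) =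
      cycle_series elem_sym n + (\<Sum>j=1..q. cycle_series elem_sym j * path_series elem_sym (n - j))"
    by (simp add: n atMost_atLeast0 sum.atLeast_Suc_atMost cycle_series_0 path_series_0 algebra_simps)
  hence "cycle_series elem_sym n = of_nat q * path_series elem_sym n -
      (\<Sum>j=1..q. cycle_series elem_sym j * path_series elem_sym (n - j))"
    using cycle_path_convolution[of n elem_sym] by (simp add: n eq_diff_eq)
  moreover have "(\<Sum>j=1..q. hat_sym 0 j 0 * path_sym (0 + q + 1 - j)) =
      (\<Sum>j=1..q. cycle_series elem_sym j * path_series elem_sym (n - j))"
    by (rule sum.cong) (auto simp: less.IH n path_sym_eq)
  ultimately show ?case using tadpole_sym_rec[of 0 q] by (simp add: n path_sym_eq)
qed

lemma tadpole_sym_eq: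
  assumes "1 \<le> s"
  shows "hat_sym 0 s b = of_nat (s - 1) * path_series elem_sym (b + s) -
     (\<Sum>j=1..s - 1. cycle_series elem_sym j * path_series elem_sym (b + s - j))"
  using tadpole_sym_rec[of b "s - 1"] hat_sym_rev[OF assms, of 0 b] assms
  by (simp add: path_sym_eq cycle_sym_eq)

text \<open>Each triple deletion moves the left end of the chord one vertex to the right, until the
  chord is a loop. The contracted stars contribute products of paths by
  \<open>contracted_sym_eq\<close>.\<close>

lemma hat_sym_eq_paths:
  "hat_sym a (q + 1) b = of_nat q * path_sym (a + q + 1 + b)
     + (\<Sum>i=1..q. of_nat (q - i) * (path_sym i * path_sym (a + q + 1 + b - i)))
     - (\<Sum>s=1..q. (of_nat (q - s) * path_sym (b + s) + hat_sym 0 s b) * path_sym (a + q + 1 - s))"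
proof (induction q arbitrary: a)
  case 0
  show ?case using hat_sym_1[of a b] by simp
next
  case (Suc q)
  have Suc_diff: "(\<Sum>i=1..Suc q. of_nat (Suc q - i) * f i) = (\<Sum>i=1..q. of_nat (q - i) * f i) + (\<Sum>i=1..q. f i)"
    for f :: "nat \<Rightarrow> (nat, rat) mpseries"
  proof -
    have "(\<Sum>i=1..q. of_nat (Suc q - i) * f i) = (\<Sum>i=1..q. of_nat (q - i) * f i + f i)"
      by (rule sum.cong) (auto simp: Suc_diff_le algebra_simps)
    thus ?thesis by (simp add: sum.distrib)
  qed
  have step: "hat_sym a (Suc q + 1) b = hat_sym (a + 1) (q + 1) b
      + path_sym (a + 1) * (path_sym (q + 1 + b) - hat_sym 0 (q + 1) b) - contracted_sym a q b"
    using hat_sym_step[of a q b] by (simp add: eq_diff_eq)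
  show ?case
    unfolding step Suc.IH[of "a + 1"] contracted_sym_eq distrib_right sum.distrib mult.assoc Suc_diff
    by (simp add: algebra_simps)
qed

subsection \<open>Expansion in the elementary basis\<close>

lemma sum_triangle_swap:
  "(\<Sum>i=1..s. \<Sum>p=1..s - i. h i p) = (\<Sum>p=1..s. \<Sum>i=1..s - p. h i p)" for s :: nat
proof -
  have *: "{p \<in> {1..s}. i + p \<le> s} = {1..s - i}" if "i \<in> {1..s}" for i
    using that by auto
  have **: "{i \<in> {1..s}. i + p \<le> s} = {1..s - p}" if "p \<in> {1..s}" for p
    using that by auto
  show ?thesis
    using sum.swap_restrict[of "{1..s}" "{1..s}" h "\<lambda>i p. i + p \<le> s"]
    by (simp only: * ** finite_atLeastAtMost cong: sum.cong)
qed

section \<open>Triple sums and the comparison of coefficients\<close>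

context
  fixes e :: "nat \<Rightarrow> 'a :: comm_ring_1"
begin

text \<open>In this form the factors behind the heads can be compared through their integer
  coefficients. The index set contains \<open>k = 0\<close>; the coefficients used below vanish
  there.\<close>

definition triple_series :: "nat \<Rightarrow> (nat \<Rightarrow> nat \<Rightarrow> int) \<Rightarrow> 'a" where
  "triple_series d f = (\<Sum>(r, k)\<in>{(r, k). r + k \<le> d}.
     of_int (f r k) * (reduced_series e r * e k * reduced_series e (d - r - k)))"

lemma triple_series_nested:
  "triple_series d f = (\<Sum>r\<le>d. \<Sum>k\<le>d - r.
     of_int (f r k) * (reduced_series e r * e k * reduced_series e (d - r - k)))"
proof -
  have "{(r, k). r + k \<le> d} = (SIGMA r:{..d}. {..d - r})" by auto
  thus ?thesis by (simp add: triple_series_def sum.Sigma)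
qed

lemma triple_series_diagonal:
  "triple_series d f = (\<Sum>i\<le>d. \<Sum>k\<le>i.
     of_int (f (i - k) k) * (reduced_series e (i - k) * e k * reduced_series e (d - i)))"
proof -
  have "triple_series d f = (\<Sum>(k, r)\<in>{(k, r). k + r \<le> d}.
      of_int (f r k) * (reduced_series e r * e k * reduced_series e (d - r - k)))"
    unfolding triple_series_def
    by (rule sum.reindex_bij_witness[where i = prod.swap and j = prod.swap]) auto
  also have "\<dots> = (\<Sum>i\<le>d. \<Sum>k\<le>i.
     of_int (f (i - k) k) * (reduced_series e (i - k) * e k * reduced_series e (d - (i - k) - k)))"
    by (rule sum.triangle_reindex_eq)
  also have "\<dots> = (\<Sum>i\<le>d. \<Sum>k\<le>i.
     of_int (f (i - k) k) * (reduced_series e (i - k) * e k * reduced_series e (d - i)))"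
    by (intro sum.cong refl) auto
  finally show ?thesis .
qed

lemma triple_series_add: "triple_series d (\<lambda>r k. f r k + g r k) = triple_series d f + triple_series d g"
  by (simp add: triple_series_nested algebra_simps sum.distrib)

lemma triple_series_diff: "triple_series d (\<lambda>r k. f r k - g r k) = triple_series d f - triple_series d g"
  by (simp add: triple_series_nested algebra_simps sum_subtractf)

lemma triple_series_cmult: "triple_series d (\<lambda>r k. c * f r k) = of_int c * triple_series d f"
  by (simp add: triple_series_nested sum_distrib_left mult.assoc)

lemma triple_series_crossing:
  assumes "M \<le> d"
  shows "triple_series d (\<lambda>r k. if r < M \<and> M \<le> r + k then f r k else 0) =
    (\<Sum>r<M. \<Sum>k=M - r..d - r.
       of_int (f r k) * (reduced_series e r * e k * reduced_series e (d - r - k)))"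
proof -
  have "triple_series d (\<lambda>r k. if r < M \<and> M \<le> r + k then f r k else 0) =
      (\<Sum>r\<le>d. if r < M then (\<Sum>k=M - r..d - r.
         of_int (f r k) * (reduced_series e r * e k * reduced_series e (d - r - k))) else 0)"
    unfolding triple_series_nested
    by (intro sum.cong refl) (auto intro!: sum.mono_neutral_cong_right)
  also have "\<dots> = (\<Sum>r<M. \<Sum>k=M - r..d - r.
         of_int (f r k) * (reduced_series e r * e k * reduced_series e (d - r - k)))"
    using assms by (intro sum.mono_neutral_cong_right) auto
  finally show ?thesis .
qed

lemma reduced_series_crossing:
  assumes "1 \<le> M" "M \<le> d"
  shows "(\<Sum>r<M. \<Sum>k=M - r..d - r.
       of_int (int k - 1) * (reduced_series e r * e k * reduced_series e (d - r - k))) = reduced_series e d"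
proof -
  have "reduced_series e d = (\<Sum>r<M. \<Sum>k=M - r..d - r. \<Sum>A\<in>compositions r. \<Sum>B\<in>compositions (d - r - k).
      of_int (reduced_weight (A @ k # B)) * prod_list (map e (A @ k # B)))"
    unfolding reduced_series_def[of e d] sum_compositions_crossing[OF assms] ..
  also have "\<dots> = (\<Sum>r<M. \<Sum>k=M - r..d - r.
       of_int (int k - 1) * (reduced_series e r * e k * reduced_series e (d - r - k)))"
    unfolding reduced_series_def sum_distrib_right
    unfolding sum_distrib_left
    by (intro sum.cong refl) (simp add: mult_ac)
  finally show ?thesis ..
qed

text \<open>Replace \<open>r R(r)\<close> by the convolution of \<open>C(j)\<close> and
  \<open>R(r - j)\<close>. For fixed \<open>j < M\<close> the rest is a crossing at height
  \<open>M - j\<close> and sums to \<open>R(d - j)\<close>. What remains is the sum of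
  \<open>C(j) R(d - j)\<close> over \<open>j < M\<close>, and expanding \<open>C(j)\<close> gives
  the right-hand side.\<close>

lemma triple_series_index_crossing:
  assumes "M \<le> d"
  shows "triple_series d (\<lambda>r k. if r < M \<and> M \<le> r + k then int r * (int k - 1) else 0) =
    triple_series d (\<lambda>r k. if r + k < M then int k * (int k - 1) else 0)"
proof -
  \<comment> \<open>\<open>Y r\<close> gathers everything from the crossing part on, when the parts
    before it sum to \<open>r\<close>.\<close>
  define Y where "Y = (\<lambda>r. \<Sum>k=M - r..d - r. of_int (int k - 1) * (e k * reduced_series e (d - r - k)))"
  have Y: "(\<Sum>r<M - j. reduced_series e r * Y (j + r)) = reduced_series e (d - j)" if "j < M" for j
  proof -
    have "reduced_series e (d - j) = (\<Sum>r<M - j. \<Sum>k=M - j - r..d - j - r.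
       of_int (int k - 1) * (reduced_series e r * e k * reduced_series e (d - j - r - k)))"
      using that assms by (subst reduced_series_crossing) auto
    thus ?thesis by (simp add: Y_def sum_distrib_left mult_ac)
  qed
  have "triple_series d (\<lambda>r k. if r < M \<and> M \<le> r + k then int r * (int k - 1) else 0) =
      (\<Sum>r<M. of_nat r * reduced_series e r * Y r)"
    unfolding triple_series_crossing[OF assms] Y_def sum_distrib_left
    by (intro sum.cong refl) (simp add: mult_ac)
  also have "\<dots> = (\<Sum>r<M. \<Sum>j\<le>r. cycle_series e j * reduced_series e (r - j) * Y r)"
    unfolding cycle_reduced_convolution[symmetric] sum_distrib_right ..
  also have "\<dots> = (\<Sum>(j, r)\<in>{(j, r). j + r < M}. cycle_series e j * reduced_series e r * Y (j + r))"
    by (subst sum.triangle_reindex) simp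
  also have "\<dots> = (\<Sum>j<M. \<Sum>r<M - j. cycle_series e j * reduced_series e r * Y (j + r))"
  proof -
    have "{(j, r). j + r < M} = (SIGMA j:{..<M}. {..<M - j})" by auto
    thus ?thesis by (simp add: sum.Sigma)
  qed
  also have "\<dots> = (\<Sum>j<M. cycle_series e j * reduced_series e (d - j))"
    by (intro sum.cong refl) (simp add: mult.assoc Y flip: sum_distrib_left)
  also have "\<dots> = (\<Sum>i\<le>d. if i < M then cycle_series e i * reduced_series e (d - i) else 0)"
    using assms by (intro sum.mono_neutral_cong_left) auto
  also have "\<dots> = triple_series d (\<lambda>r k. if r + k < M then int k * (int k - 1) else 0)"
    unfolding triple_series_diagonal cycle_series_def sum_distrib_right
    by (intro sum.cong refl) (auto intro!: sum.cong simp: mult_ac)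
  finally show ?thesis .
qed

text \<open>The first part \<open>k\<close> is split off the composition behind
  \<open>path_series e i\<close>, so that \<open>i = r + k\<close>.\<close>

lemma path_reduced_convolution:
  "(\<Sum>i=1..d. of_int (f i) * (path_series e i * reduced_series e (d - i))) =
     triple_series d (\<lambda>r k. f (r + k) * int k)"
proof -
  have "(\<Sum>i=1..d. of_int (f i) * (path_series e i * reduced_series e (d - i))) =
      (\<Sum>i=1..d. \<Sum>k\<le>i. of_int (f i * int k) * (reduced_series e (i - k) * e k * reduced_series e (d - i)))"
  proof (rule sum.cong[OF refl])
    fix i assume "i \<in> {1..d}"
    hence "path_series e i = (\<Sum>k\<le>i. of_nat k * e k * reduced_series e (i - k))"
      by (simp add: path_series_rec atMost_atLeast0 sum.atLeast_Suc_atMost)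
    thus "of_int (f i) * (path_series e i * reduced_series e (d - i)) =
        (\<Sum>k\<le>i. of_int (f i * int k) * (reduced_series e (i - k) * e k * reduced_series e (d - i)))"
      by (simp add: sum_distrib_left sum_distrib_right mult_ac)
  qed
  also have "\<dots> = (\<Sum>i\<le>d. \<Sum>k\<le>i. of_int (f i * int k) * (reduced_series e (i - k) * e k * reduced_series e (d - i)))"
    by (simp add: atMost_atLeast0 sum.atLeast_Suc_atMost)
  also have "\<dots> = triple_series d (\<lambda>r k. f (r + k) * int k)"
    unfolding triple_series_diagonal by (intro sum.cong refl) auto
  finally show ?thesis .
qed

lemma reduced_path_window:
  assumes "M \<le> d"
  shows "(\<Sum>r<M. of_int (f r) * (reduced_series e r * path_series e (d - r))) =
     triple_series d (\<lambda>r k. if r < M then f r * int k else 0)"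
proof -
  have "(\<Sum>r<M. of_int (f r) * (reduced_series e r * path_series e (d - r))) =
      (\<Sum>r<M. \<Sum>k\<le>d - r. of_int (f r * int k) * (reduced_series e r * e k * reduced_series e (d - r - k)))"
  proof (rule sum.cong[OF refl])
    fix r assume "r \<in> {..<M}"
    hence "path_series e (d - r) = (\<Sum>k\<le>d - r. of_nat k * e k * reduced_series e (d - r - k))"
      using assms by (simp add: path_series_rec atMost_atLeast0 sum.atLeast_Suc_atMost)
    thus "of_int (f r) * (reduced_series e r * path_series e (d - r)) =
      (\<Sum>k\<le>d - r. of_int (f r * int k) * (reduced_series e r * e k * reduced_series e (d - r - k)))"
      by (simp add: sum_distrib_left mult_ac)
  qed
  also have "\<dots> = triple_series d (\<lambda>r k. if r < M then f r * int k else 0)"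
    unfolding triple_series_nested using assms by (intro sum.mono_neutral_cong_left) auto
  finally show ?thesis .
qed

text \<open>Coefficient of \<open>e\<^sub>k\<close> in the contribution of a composition \<open>K = J A k B\<close> with \<open>N\<^sub>K \<noteq> 0\<close>, where
  \<open>J\<close> is the head, \<open>r = |A|\<close> and \<open>k\<close> is the part reaching the height \<open>b + m\<close> with \<open>m = q + 1\<close>.\<close>

definition crossing_coeff :: "nat \<Rightarrow> nat \<Rightarrow> nat \<Rightarrow> int" where
  "crossing_coeff q r k =
     (if q < r + k then int r + int k - int q else (int q - int r - int k) * (int k - 1))"

text \<open>Expanding \<open>q R(d)\<close> at the crossing of height \<open>M\<close> gives the
  coefficient \<open>q (k - 1)\<close>, where \<open>(q - r) (k - 1)\<close> is wanted. By
  \<open>triple_series_index_crossing\<close> the difference can be traded for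
  \<open>k (k - 1)\<close> below the crossing; then the coefficients agree for all \<open>r\<close>
  and \<open>k\<close>.\<close>

lemma window_identity:
  assumes "1 \<le> M" "M \<le> d" "M \<le> q"
  shows "of_nat q * reduced_series e d + triple_series d (\<lambda>r k. int (q - (r + k)) * int k)
      - triple_series d (\<lambda>r k. if r < M then (int q - 1 - int r) * int k else 0) =
    triple_series d (\<lambda>r k. if r < M \<and> M \<le> r + k then crossing_coeff q r k else 0)
      + triple_series d (\<lambda>r k. if M \<le> r then int (q - (r + k)) * int k else 0)"
proof -
  have "of_nat q * reduced_series e d =
      of_int (int q) * triple_series d (\<lambda>r k. if r < M \<and> M \<le> r + k then int k - 1 else 0)"
    unfolding triple_series_crossing[OF assms(2)] reduced_series_crossing[OF assms(1,2)] by simp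
  \<comment> \<open>The two new series cancel each other by
    \<open>triple_series_index_crossing\<close>.\<close>
  also have "\<dots> = triple_series d (\<lambda>r k. int q * (if r < M \<and> M \<le> r + k then int k - 1 else 0))
      - triple_series d (\<lambda>r k. if r < M \<and> M \<le> r + k then int r * (int k - 1) else 0)
      + triple_series d (\<lambda>r k. if r + k < M then int k * (int k - 1) else 0)"
    unfolding triple_series_cmult triple_series_index_crossing[OF assms(2)] by simp
  also have "\<dots> = triple_series d (\<lambda>r k. (if r < M \<and> M \<le> r + k then crossing_coeff q r k else 0)
      + (if M \<le> r then int (q - (r + k)) * int k else 0) - int (q - (r + k)) * int k
      + (if r < M then (int q - 1 - int r) * int k else 0))"
    unfolding triple_series_add[symmetric] triple_series_diff[symmetric]
  proof (intro arg_cong[where f = "triple_series d"] ext)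
    fix r k
    \<comment> \<open>Natural subtraction truncates for \<open>q < r + k\<close>. As
      \<open>M \<le> q\<close>, this does not happen below the crossing.\<close>
    have "int (q - (r + k)) = (if r + k \<le> q then int q - int r - int k else 0)"
      by auto
    thus "int q * (if r < M \<and> M \<le> r + k then int k - 1 else 0) -
        (if r < M \<and> M \<le> r + k then int r * (int k - 1) else 0) +
        (if r + k < M then int k * (int k - 1) else 0) =
        (if r < M \<and> M \<le> r + k then crossing_coeff q r k else 0) +
        (if M \<le> r then int (q - (r + k)) * int k else 0) - int (q - (r + k)) * int k +
        (if r < M then (int q - 1 - int r) * int k else 0)"
      using assms(3) by (auto simp: crossing_coeff_def algebra_simps)
  qed
  finally show ?thesis
    by (simp add: triple_series_add triple_series_diff algebra_simps)
qed

text \<open>Behind a head of overshoot \<open>p\<close> the cycles convolve to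
  \<open>(s - p) R(s - p)\<close> by \<open>cycle_reduced_convolution\<close>; the rest of the
  coefficient is \<open>(q - s) + (s - 1) = q - 1\<close>.\<close>

lemma tadpole_head:
  assumes "1 \<le> s" "s \<le> q"
  shows "of_nat (q - s) * path_series e (b + s) + (of_nat (s - 1) * path_series e (b + s) -
      (\<Sum>j=1..s - 1. cycle_series e j * path_series e (b + s - j))) =
    (\<Sum>p=1..s. head_series e b p * (of_int (int q - 1 - int (s - p)) * reduced_series e (s - p)))"
proof -
  have "(\<Sum>j=1..s - 1. cycle_series e j * path_series e (b + s - j)) =
      (\<Sum>j=1..s - 1. \<Sum>p=1..s - j. head_series e b p * (cycle_series e j * reduced_series e (s - p - j)))"
  proof (rule sum.cong[OF refl])
    fix j assume "j \<in> {1..s - 1}"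
    hence "1 \<le> s - j" "b + s - j = b + (s - j)" by auto
    from path_series_head[OF this(1), of e b, folded this(2)] show "cycle_series e j * path_series e (b + s - j) =
        (\<Sum>p=1..s - j. head_series e b p * (cycle_series e j * reduced_series e (s - p - j)))"
      by (simp add: sum_distrib_left mult_ac add.commute)
  qed
  also have "\<dots> = (\<Sum>j=1..s. \<Sum>p=1..s - j. head_series e b p * (cycle_series e j * reduced_series e (s - p - j)))"
    using assms by (cases s) auto
  also have "\<dots> = (\<Sum>p=1..s. \<Sum>j=1..s - p. head_series e b p * (cycle_series e j * reduced_series e (s - p - j)))"
    by (rule sum_triangle_swap)
  also have "\<dots> = (\<Sum>p=1..s. head_series e b p * (of_nat (s - p) * reduced_series e (s - p)))"
    unfolding cycle_reduced_convolution[symmetric]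
    by (simp add: atMost_atLeast0 sum.atLeast_Suc_atMost cycle_series_0 sum_distrib_left)
  finally have C: "(\<Sum>j=1..s - 1. cycle_series e j * path_series e (b + s - j)) = \<dots>" .
  have "of_nat (q - s) + of_nat (s - 1) = (of_int (int q - 1) :: 'a)"
    using assms by (simp add: of_nat_diff)
  hence "of_nat (q - s) * path_series e (b + s) + of_nat (s - 1) * path_series e (b + s) =
      of_int (int q - 1) * path_series e (b + s)"
    by (metis distrib_right)
  also have "\<dots> = (\<Sum>p=1..s. head_series e b p * (of_int (int q - 1) * reduced_series e (s - p)))"
    unfolding path_series_head[OF assms(1)] sum_distrib_left by (simp add: mult_ac)
  finally have "of_nat (q - s) * path_series e (b + s) + of_nat (s - 1) * path_series e (b + s) = \<dots>" .
  thus ?thesis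
    unfolding add_diff_eq C
    by (simp add: sum_subtractf[symmetric] algebra_simps)
qed

text \<open>All sums are collected by head. For \<open>p \<le> q\<close> the height
  \<open>b + q + 1\<close> lies beyond the head and \<open>window_identity\<close> applies with
  \<open>M = q + 1 - p\<close>; for \<open>q < p\<close> the head itself reaches it.\<close>

lemma hat_head_expansion:
  assumes c: "c = a + q + 1"
  shows "of_nat q * path_series e (b + c)
     + (\<Sum>i=1..q. of_nat (q - i) * (path_series e i * path_series e (b + c - i)))
     - (\<Sum>s=1..q. (of_nat (q - s) * path_series e (b + s) + (of_nat (s - 1) * path_series e (b + s) -
      (\<Sum>j=1..s - 1. cycle_series e j * path_series e (b + s - j)))) * path_series e (c - s)) =
    (\<Sum>p=1..c. head_series e b p *
      ((if q < p then of_nat q * reduced_series e (c - p)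
        else triple_series (c - p) (\<lambda>r k. if r < q + 1 - p \<and> q + 1 - p \<le> r + k then crossing_coeff q r k else 0))
       + triple_series (c - p) (\<lambda>r k. if q + 1 - p \<le> r then int (q - (r + k)) * int k else 0)))"
proof -
  have "1 \<le> c" using c by simp
  have 1: "of_nat q * path_series e (b + c) =
      (\<Sum>p=1..c. head_series e b p * (of_nat q * reduced_series e (c - p)))"
    using \<open>1 \<le> c\<close> by (simp add: path_series_head sum_distrib_left mult_ac)
  have "(\<Sum>i=1..q. of_nat (q - i) * (path_series e i * path_series e (b + c - i))) =
      (\<Sum>i=1..c. of_nat (q - i) * (path_series e i * path_series e (b + c - i)))"
    using c by (intro sum.mono_neutral_left) auto
  also have "\<dots> = (\<Sum>i=1..c. \<Sum>p=1..c - i.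
      head_series e b p * (of_nat (q - i) * (path_series e i * reduced_series e (c - p - i))))"
  proof (rule sum.cong[OF refl])
    fix i assume i: "i \<in> {1..c}"
    show "of_nat (q - i) * (path_series e i * path_series e (b + c - i)) = (\<Sum>p=1..c - i.
        head_series e b p * (of_nat (q - i) * (path_series e i * reduced_series e (c - p - i))))"
    proof (cases "i < c")
      case True
      thus ?thesis using path_series_head[of "c - i" e b]
        by (simp add: sum_distrib_left mult_ac add.commute)
    next
      case False
      with i c show ?thesis by simp
    qed
  qed
  also have "\<dots> = (\<Sum>p=1..c. \<Sum>i=1..c - p.
      head_series e b p * (of_nat (q - i) * (path_series e i * reduced_series e (c - p - i))))"
    by (rule sum_triangle_swap)
  also have "\<dots> = (\<Sum>p=1..c. head_series e b p * triple_series (c - p) (\<lambda>r k. int (q - (r + k)) * int k))"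
    unfolding path_reduced_convolution[where f = "\<lambda>i. int (q - i)", symmetric]
    by (simp add: sum_distrib_left)
  finally have 2: "(\<Sum>i=1..q. of_nat (q - i) * (path_series e i * path_series e (b + c - i))) = \<dots>" .
  have "(\<Sum>s=1..q. (of_nat (q - s) * path_series e (b + s) + (of_nat (s - 1) * path_series e (b + s) -
      (\<Sum>j=1..s - 1. cycle_series e j * path_series e (b + s - j)))) * path_series e (c - s)) =
      (\<Sum>s=1..q. \<Sum>p | p \<in> {1..c} \<and> p \<le> s. head_series e b p *
        (of_int (int q - 1 - int (s - p)) * (reduced_series e (s - p) * path_series e (c - s))))"
  proof (rule sum.cong[OF refl])
    fix s assume s: "s \<in> {1..q}"
    hence p: "{p. p \<in> {1..c} \<and> p \<le> s} = {1..s}" using c by auto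
    have s': "1 \<le> s" "s \<le> q" using s by auto
    show "(of_nat (q - s) * path_series e (b + s) + (of_nat (s - 1) * path_series e (b + s) -
      (\<Sum>j=1..s - 1. cycle_series e j * path_series e (b + s - j)))) * path_series e (c - s) =
      (\<Sum>p | p \<in> {1..c} \<and> p \<le> s. head_series e b p *
        (of_int (int q - 1 - int (s - p)) * (reduced_series e (s - p) * path_series e (c - s))))"
      unfolding p tadpole_head[OF s'] sum_distrib_right by (simp only: mult_ac)
  qed
  also have "\<dots> = (\<Sum>p=1..c. \<Sum>s | s \<in> {1..q} \<and> p \<le> s. head_series e b p *
        (of_int (int q - 1 - int (s - p)) * (reduced_series e (s - p) * path_series e (c - s))))"
    by (rule sum.swap_restrict) auto
  also have "\<dots> = (\<Sum>p=1..c. head_series e b p * triple_series (c - p)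
      (\<lambda>r k. if r < q + 1 - p then (int q - 1 - int r) * int k else 0))"
  proof (rule sum.cong[OF refl])
    fix p assume p: "p \<in> {1..c}"
    have "(\<Sum>s | s \<in> {1..q} \<and> p \<le> s.
        of_int (int q - 1 - int (s - p)) * (reduced_series e (s - p) * path_series e (c - s))) =
      (\<Sum>r<q + 1 - p. of_int (int q - 1 - int r) * (reduced_series e r * path_series e (c - p - r)))"
      using p by (intro sum.reindex_bij_witness[where i = "\<lambda>r. r + p" and j = "\<lambda>s. s - p"]) auto
    also have "\<dots> = triple_series (c - p) (\<lambda>r k. if r < q + 1 - p then (int q - 1 - int r) * int k else 0)"
      using c by (intro reduced_path_window) auto
    finally show "(\<Sum>s | s \<in> {1..q} \<and> p \<le> s. head_series e b p *
        (of_int (int q - 1 - int (s - p)) * (reduced_series e (s - p) * path_series e (c - s)))) =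
      head_series e b p * triple_series (c - p)
      (\<lambda>r k. if r < q + 1 - p then (int q - 1 - int r) * int k else 0)"
      by (simp flip: sum_distrib_left)
  qed
  finally have 3: "(\<Sum>s=1..q. (of_nat (q - s) * path_series e (b + s) + (of_nat (s - 1) * path_series e (b + s) -
      (\<Sum>j=1..s - 1. cycle_series e j * path_series e (b + s - j)))) * path_series e (c - s)) = \<dots>" .
  show ?thesis
    unfolding 1 2 3 sum.distrib[symmetric] sum_subtractf[symmetric] distrib_left[symmetric]
      right_diff_distrib[symmetric]
  proof (intro sum.cong refl arg_cong2[where f = "(*)"])
    fix p assume p: "p \<in> {1..c}"
    show "of_nat q * reduced_series e (c - p) + triple_series (c - p) (\<lambda>r k. int (q - (r + k)) * int k) -
        triple_series (c - p) (\<lambda>r k. if r < q + 1 - p then (int q - 1 - int r) * int k else 0) =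
      (if q < p then of_nat q * reduced_series e (c - p)
        else triple_series (c - p) (\<lambda>r k. if r < q + 1 - p \<and> q + 1 - p \<le> r + k then crossing_coeff q r k else 0))
       + triple_series (c - p) (\<lambda>r k. if q + 1 - p \<le> r then int (q - (r + k)) * int k else 0)"
    proof (cases "q < p")
      case True
      \<comment> \<open>Truncation makes \<open>q + 1 - p\<close> zero: no \<open>r\<close> lies
        below it, and \<open>q + 1 - p \<le> r\<close> always holds.\<close>
      have "triple_series (c - p) (\<lambda>r k. 0) = 0" by (simp add: triple_series_nested)
      with True show ?thesis by simp
    next
      case False
      with p c show ?thesis by (subst window_identity) auto
    qed
  qed
qed

end

subsection \<open>The composition sums\<close>

lemma mpconst_of_int: "mpconst (of_int z) = (of_int z :: ('v, 'a :: comm_ring_1) mpseries)"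
proof -
  have add: "mpconst (x + y) = (mpconst x + mpconst y :: ('v, 'a) mpseries)" for x y
    by (rule mpseries_eqI) (simp add: mpconst.rep_eq plus_mpseries.rep_eq)
  have minus: "mpconst (- x) = (- mpconst x :: ('v, 'a) mpseries)" for x
    by (rule mpseries_eqI) (simp add: mpconst.rep_eq uminus_mpseries.rep_eq)
  have zero: "mpconst 0 = (0 :: ('v, 'a) mpseries)"
    by (rule mpseries_eqI) (simp add: mpconst.rep_eq zero_mpseries.rep_eq)
  have one: "mpconst 1 = (1 :: ('v, 'a) mpseries)"
    by (rule mpseries_eqI) (simp add: mpconst.rep_eq one_mpseries.rep_eq)
  have nat: "mpconst (of_nat k) = (of_nat k :: ('v, 'a) mpseries)" for k
    by (induction k) (simp_all add: zero add one)
  show ?thesis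
    by (cases z) (simp_all add: nat minus add one del: of_nat_Suc)
qed

text \<open>Joins the first two sums of the claim into one sum over all compositions; those with
  \<open>hat_N m b K = 0\<close> get coefficient 0.\<close>

definition hat_coeff :: "nat \<Rightarrow> nat \<Rightarrow> nat list \<Rightarrow> rat" where
  "hat_coeff m b K =
     (if hat_N m b K \<le> -1 then of_int (- hat_N m b K * comp_weight K) /
        of_int (Theta_plus K (b + m) + Theta_minus K (b + m - 1))
      else if hat_N m b K \<ge> 1 then of_int (hat_N m b K * comp_weight K) else 0)"

text \<open>The last part of the head passes both heights \<open>b + 1\<close> and
  \<open>b + m\<close>, so the two values of \<open>sigma_plus\<close> agree and
  \<open>N\<^sub>K = m - 1 = q\<close>.\<close>

lemma hat_coeff_long_head:
  assumes "1 \<le> q" "sum_list A \<le> b" "q < p"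
  shows "hat_coeff (q + 1) b ((A @ [b + p - sum_list A]) @ B) =
    of_int (int q * comp_weight (A @ [b + p - sum_list A]) * reduced_weight B)"
proof -
  let ?K = "(A @ [b + p - sum_list A]) @ B"
  have "sigma_plus ?K c = b + p" if "b < c" "c \<le> b + p" for c
    using that assms sigma_plus_crossing[of A c "b + p - sum_list A" B] by simp
  hence "hat_N (q + 1) b ?K = int q"
    using assms by (simp add: hat_N_def Theta_plus_def)
  thus ?thesis using assms(1)
    by (simp add: hat_coeff_def comp_weight_append mult.assoc del: append_assoc)
qed

text \<open>The heights \<open>b + 1\<close> and \<open>b + m\<close> are reached by different
  parts. The denominator is then \<open>k - 1\<close>, the factor that the part \<open>k\<close>
  contributes to \<open>w\<^sub>K\<close>, so the quotient is an integer.\<close>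

lemma hat_coeff_short_head:
  assumes "1 \<le> p" "sum_list A \<le> b" "p + sum_list A' \<le> q" "q < p + sum_list A' + k"
  shows "hat_coeff (q + 1) b ((A @ [b + p - sum_list A]) @ A' @ k # B) =
    of_int (crossing_coeff q (sum_list A') k *
      (comp_weight (A @ [b + p - sum_list A]) * (reduced_weight A' * reduced_weight B)))"
proof -
  let ?J = "A @ [b + p - sum_list A]"
  let ?K = "?J @ A' @ k # B"
  have J: "sum_list ?J = b + p" using assms by simp
  have 1: "sigma_plus ?K (b + 1) = b + p"
    using assms sigma_plus_crossing[of A "b + 1" "b + p - sum_list A" "A' @ k # B"] by simp
  have 2: "sigma_plus ?K (b + (q + 1)) = b + p + sum_list A' + k"
    using assms J sigma_plus_crossing[of "?J @ A'" "b + (q + 1)" k B] by simp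
  have 3: "sigma_minus ?K (b + (q + 1) - 1) = b + p + sum_list A'"
    using assms J sigma_minus_crossing[of "?J @ A'" "b + (q + 1)" k B] by simp
  have N: "hat_N (q + 1) b ?K = int q - int (sum_list A') - int k"
    unfolding hat_N_def Theta_plus_def 1 2 by simp
  have D: "Theta_plus ?K (b + (q + 1)) + Theta_minus ?K (b + (q + 1) - 1) = int k - 1"
    unfolding Theta_plus_def Theta_minus_def 2 3 by simp
  have W: "comp_weight ?K = (int k - 1) * (comp_weight ?J * (reduced_weight A' * reduced_weight B))"
    by (simp add: comp_weight_append del: append_assoc)
  show ?thesis
  proof (cases "q < sum_list A' + k")
    case True
    \<comment> \<open>Here \<open>k \<ge> 2\<close>, because
      \<open>p + sum_list A' \<le> q < sum_list A' + k\<close> and \<open>1 \<le> p\<close>.\<close>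
    hence "(of_int (int k - 1) :: rat) \<noteq> 0" using assms by simp
    moreover have "y * (v * x) / v = y * x" if "v \<noteq> 0" for v x y :: rat
      using that by simp
    ultimately have div:
        "of_int (y * ((int k - 1) * x)) / of_int (int k - 1) = (of_int (y * x) :: rat)" for x y
      unfolding of_int_mult by blast
    have "int q - int (sum_list A') - int k \<le> -1" using True by simp
    thus ?thesis
      unfolding hat_coeff_def N D W crossing_coeff_def div using True
      by (simp only: if_True) (simp add: algebra_simps)
  next
    case False
    show ?thesis
    proof (cases "q = sum_list A' + k")
      case True
      thus ?thesis unfolding hat_coeff_def N crossing_coeff_def by simp
    next
      case neq: False
      thus ?thesis
        unfolding hat_coeff_def N W crossing_coeff_def using False by (simp add: mult.assoc)
    qed
  qed
qed

lemma elem_sym_comp_append: "elem_sym_comp (I @ J) = elem_sym_comp I * elem_sym_comp J"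
  by (simp add: elem_sym_comp_def)

text \<open>For \<open>p \<le> q\<close> the piece behind the head is cut once more at height
  \<open>q + 1 - p\<close>, which is \<open>b + m\<close> in the whole composition.\<close>

lemma sum_hat_coeff:
  assumes "1 \<le> q" and c: "c = a + q + 1"
  shows "(\<Sum>K\<in>compositions (b + c). mpconst (hat_coeff (q + 1) b K) * elem_sym_comp K) =
    (\<Sum>p=1..c. head_series elem_sym b p *
      (if q < p then of_nat q * reduced_series elem_sym (c - p)
       else triple_series elem_sym (c - p)
         (\<lambda>r k. if r < q + 1 - p \<and> q + 1 - p \<le> r + k then crossing_coeff q r k else 0)))"
proof -
  let ?h = "\<lambda>K. mpconst (hat_coeff (q + 1) b K) * elem_sym_comp K"
  have "1 \<le> c" using c by simp
  show ?thesis
    unfolding sum_compositions_head[OF \<open>1 \<le> c\<close>] head_series_def sum_distrib_right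
  proof (intro sum.cong refl)
    fix p r A
    assume p: "p \<in> {1..c}" and r: "r \<in> {..b}" and A: "A \<in> compositions r"
    let ?J = "A @ [b + p - r]"
    have rA: "r = sum_list A" "sum_list A \<le> b" using A r by (auto simp: compositionsD)
    show "(\<Sum>B\<in>compositions (c - p). ?h (?J @ B)) =
        of_int (comp_weight ?J) * prod_list (map elem_sym ?J) *
        (if q < p then of_nat q * reduced_series elem_sym (c - p)
         else triple_series elem_sym (c - p)
           (\<lambda>r k. if r < q + 1 - p \<and> q + 1 - p \<le> r + k then crossing_coeff q r k else 0))"
    proof (cases "q < p")
      case True
      have h: "?h (?J @ B) = of_int (comp_weight ?J) * prod_list (map elem_sym ?J) *
          (of_nat q * (of_int (reduced_weight B) * prod_list (map elem_sym B)))" for B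
        unfolding rA(1) hat_coeff_long_head[OF assms(1) rA(2) True] mpconst_of_int
          elem_sym_comp_append elem_sym_comp_def
        by (simp add: mult_ac)
      show ?thesis
        using True unfolding h reduced_series_def by (simp add: sum_distrib_left)
    next
      case False
      define M where "M = q + 1 - p"
      have M: "1 \<le> M" "M \<le> c - p" using False c by (auto simp: M_def)
      have h: "?h (?J @ A' @ k # B) = of_int (comp_weight ?J) * prod_list (map elem_sym ?J) *
          (of_int (crossing_coeff q r' k) * (of_int (reduced_weight A') * prod_list (map elem_sym A') *
            elem_sym k * (of_int (reduced_weight B) * prod_list (map elem_sym B))))"
        if "r' < M" "M - r' \<le> k" "A' \<in> compositions r'" for r' k A' B
      proof -
        have r': "sum_list A' = r'" using that(3) by (rule compositionsD)
        have "p + sum_list A' \<le> q" "q < p + sum_list A' + k" "1 \<le> p"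
          using that(1,2) p by (auto simp: M_def r')
        thus ?thesis
          unfolding rA(1) hat_coeff_short_head[OF \<open>1 \<le> p\<close> rA(2) \<open>p + sum_list A' \<le> q\<close> \<open>q < p + sum_list A' + k\<close>]
            mpconst_of_int elem_sym_comp_append elem_sym_comp_def r'
          by (simp add: mult_ac)
      qed
      have "(\<Sum>B\<in>compositions (c - p). ?h (?J @ B)) =
          (\<Sum>r'<M. \<Sum>k=M - r'..c - p - r'. \<Sum>A'\<in>compositions r'. \<Sum>B\<in>compositions (c - p - r' - k).
            of_int (comp_weight ?J) * prod_list (map elem_sym ?J) *
            (of_int (crossing_coeff q r' k) * (of_int (reduced_weight A') * prod_list (map elem_sym A') *
            elem_sym k * (of_int (reduced_weight B) * prod_list (map elem_sym B)))))"
        unfolding sum_compositions_crossing[OF M]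
        by (intro sum.cong refl h) auto
      also have "\<dots> = of_int (comp_weight ?J) * prod_list (map elem_sym ?J) * triple_series elem_sym (c - p)
           (\<lambda>r k. if r < M \<and> M \<le> r + k then crossing_coeff q r k else 0)"
        unfolding triple_series_crossing[OF M(2)] reduced_series_def sum_distrib_right
        unfolding sum_distrib_left ..
      finally show ?thesis using False by (simp add: M_def)
    qed
  qed
qed

text \<open>The next partial sum after \<open>sum_list A\<close> is \<open>sum_list A + i\<close>,
  so the maximum gets past \<open>A\<close> only if the part \<open>i\<close> still fits within
  \<open>c\<close>. It is applied to the reversal of \<open>K\<close>, with \<open>rev J2\<close>
  for \<open>A\<close> and \<open>hd I\<close> for \<open>i\<close>.\<close>

lemma sigma_minus_first_part:
  assumes "0 < i"
  shows "sum_list A + 1 \<le> sigma_minus (A @ i # B) c \<longleftrightarrow> sum_list A + i \<le> c"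
proof
  assume *: "sum_list A + i \<le> c"
  have "sum_list A + i \<le> sigma_minus (A @ i # B) c"
    unfolding sigma_minus_def
    using * by (intro Max_ge) (auto intro!: exI[of _ "Suc (length A)"])
  thus "sum_list A + 1 \<le> sigma_minus (A @ i # B) c" using assms by simp
next
  assume *: "sum_list A + 1 \<le> sigma_minus (A @ i # B) c"
  have "sigma_minus (A @ i # B) c \<in>
      {sum_list (take k (A @ i # B)) |k. k \<le> length (A @ i # B) \<and> sum_list (take k (A @ i # B)) \<le> c}"
    unfolding sigma_minus_def by (rule Max_in) (auto intro!: exI[of _ 0])
  hence "sigma_minus (A @ i # B) c \<le> c" by auto
  with * have "sum_list A < c + 1" by simp
  thus "sum_list A + i \<le> c"
    using * sigma_minus_crossing[of A "c + 1" i B] by (cases "c + 1 \<le> sum_list A + i") auto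
qed

text \<open>By \<open>sigma_minus_first_part\<close> the first family demands
  \<open>|J2| + hd I \<le> a\<close>, which amounts to \<open>|J1| + |I| - hd I \<ge> b + m\<close>
  since the total is \<open>a + m + b\<close>. The second family satisfies this because
  \<open>hd I \<le> |I|\<close>, and the third is the case \<open>hd I = 1\<close>.\<close>

lemma hat_S_iff:
  "(I, J) \<in> hat_S a m b \<longleftrightarrow> I \<noteq> [] \<and> I @ J \<in> compositions (a + m + b) \<and> sum_list I + 2 \<le> m \<and>
     b + m + hd I \<le> sigma_plus J (b + 1) + sum_list I" (is "?L \<longleftrightarrow> ?R")
proof -
  have first_part: "hd I \<le> sum_list I" if "I \<noteq> []" using that by (cases I) auto
  have key: "(sum_list J2 + 1 \<le> sigma_minus (rev (J1 @ rev I @ J2)) a) \<longleftrightarrow> sum_list J2 + hd I \<le> a"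
    if "I \<noteq> []" "0 < hd I" for J1 J2
    using that sigma_minus_first_part[of "hd I" "rev J2" "tl I @ rev J1" a]
    by (cases I) (auto simp: sum_list_rev)
  have comp: "J1 @ rev I @ J2 \<in> compositions k \<longleftrightarrow> I @ J1 @ J2 \<in> compositions k" for J1 J2 k
    by (auto simp: compositions_def sum_list_rev)
  have pos: "0 < hd I" if "I \<noteq> []" "I @ J1 @ J2 \<in> compositions k" for J1 J2 k
    using that by (cases I) (auto simp: compositions_def)
  show ?thesis
  proof
    assume ?L
    then consider
        (1) J1 J2 where "bisection b J J1 J2" "J1 @ rev I @ J2 \<in> compositions (a + m + b)"
          "2 \<le> sum_list I" "sum_list I + 2 \<le> m"
          "sum_list J2 + 1 \<le> sigma_minus (rev (J1 @ rev I @ J2)) a"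
      | (2) J1 J2 where "bisection b J J1 J2" "J1 @ rev I @ J2 \<in> compositions (a + m + b)"
          "b + m \<le> sum_list J1" "2 \<le> sum_list I" "sum_list I + 2 \<le> m"
      | (3) J1 J2 where "bisection b J J1 J2" "I @ J \<in> compositions (a + m + b)"
          "I \<noteq> []" "hd I = 1" "sum_list I + 2 \<le> m" "sum_list J2 + 1 \<le> a"
      unfolding hat_S_def by blast
    thus ?R
    proof cases
      case 1
      have J: "J = J1 @ J2" "sum_list J1 = sigma_plus J (b + 1)" using 1(1) by (auto simp: bisection_def)
      have I: "I \<noteq> []" and IJ: "I @ J1 @ J2 \<in> compositions (a + m + b)" using 1 comp by auto
      have "sum_list J2 + hd I \<le> a" using key[OF I pos[OF I IJ]] 1(5) by blast
      thus ?thesis using I IJ J 1(4) compositionsD[OF IJ] by simp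
    next
      case 2
      have J: "J = J1 @ J2" "sum_list J1 = sigma_plus J (b + 1)" using 2(1) by (auto simp: bisection_def)
      have I: "I \<noteq> []" and IJ: "I @ J1 @ J2 \<in> compositions (a + m + b)" using 2 comp by auto
      show ?thesis using I IJ J 2(3,5) first_part[OF I] by simp
    next
      case 3
      have J: "J = J1 @ J2" "sum_list J1 = sigma_plus J (b + 1)" using 3(1) by (auto simp: bisection_def)
      show ?thesis using 3 J compositionsD[OF 3(2)] by simp
    qed
  next
    assume R: ?R
    hence I: "I \<noteq> []" and IJ: "I @ J \<in> compositions (a + m + b)" by auto
    have n: "sum_list I + sum_list J = a + m + b" using compositionsD[OF IJ] by simp
    \<comment> \<open>\<open>I\<close> uses at most \<open>m - 2\<close> of the total, so the
      minimum in \<open>sigma_plus J (b + 1)\<close> runs over a nonempty set.\<close>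
    hence "b + 1 \<le> sum_list J" using R by linarith
    then obtain A k B where A: "J = A @ k # B" "sum_list A < b + 1" "b + 1 \<le> sum_list A + k"
      using crossing_exists[of "b + 1" J] by auto
    define J1 where "J1 = A @ [k]"
    have J: "J = J1 @ B" by (simp add: J1_def A)
    have s: "sum_list J1 = sigma_plus J (b + 1)"
      unfolding A(1) sigma_plus_crossing[OF A(2,3)] by (simp add: J1_def)
    have bis: "bisection b J J1 B" by (simp add: bisection_def s J[symmetric])
    have hd: "0 < hd I" using pos[OF I, of J1 B] IJ J by simp
    note k = key[OF I hd, of B J1]
    have eq: "sum_list B + hd I \<le> a \<longleftrightarrow> b + m + hd I \<le> sum_list J1 + sum_list I"
      using n unfolding J by auto
    have K: "J1 @ rev I @ B \<in> compositions (a + m + b)" using IJ comp J by simp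
    have s2: "sum_list I + 2 \<le> m" using R by blast
    have B: "sum_list B + hd I \<le> a" using R eq s by simp
    consider "hd I \<noteq> 1" "sum_list J1 + 1 \<le> b + m" | "hd I \<noteq> 1" "b + m \<le> sum_list J1" | "hd I = 1"
      by linarith
    thus ?L
    proof cases
      case 1
      have "2 \<le> sum_list I" using first_part[OF I] hd 1 by linarith
      moreover have "sum_list B + 1 \<le> sigma_minus (rev (J1 @ rev I @ B)) a" using k B by blast
      ultimately show ?thesis unfolding hat_S_def using bis K 1 s2 by blast
    next
      case 2
      have "2 \<le> sum_list I" using first_part[OF I] hd 2 by linarith
      thus ?thesis unfolding hat_S_def using bis K 2 s2 by blast
    next
      case 3
      have "sum_list B + 1 \<le> a" using B 3 by simp
      thus ?thesis unfolding hat_S_def using bis IJ I 3 s2 by blast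
    qed
  qed
qed

text \<open>If \<open>k\<close> is the first part of \<open>I\<close>, \<open>r\<close> the sum of
  its other parts and \<open>p\<close> the overshoot of the head of \<open>J\<close>, then the last
  condition of \<open>hat_S_iff\<close> reads \<open>q + 1 - p \<le> r\<close>.\<close>

lemma sum_hat_S:
  assumes c: "c = a + q + 1"
  shows "(\<Sum>(I, J)\<in>hat_S a (q + 1) b.
      mpconst (of_int ((int (q + 1) - 1 - int (sum_list I)) * comp_weight I * comp_weight J))
        * elem_sym_comp (I @ J)) =
    (\<Sum>p=1..c. head_series elem_sym b p *
      triple_series elem_sym (c - p) (\<lambda>r k. if q + 1 - p \<le> r then int (q - (r + k)) * int k else 0))"
proof -
  let ?e = "\<lambda>K. prod_list (map elem_sym K)"
  let ?cond = "\<lambda>I J. b + (q + 1) + hd I \<le> sigma_plus J (b + 1) + sum_list I"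
  let ?h = "\<lambda>I J. of_int (int (q - sum_list I) * comp_weight I * comp_weight J) * ?e (I @ J)"
  have "(\<Sum>(I, J)\<in>hat_S a (q + 1) b.
      mpconst (of_int ((int (q + 1) - 1 - int (sum_list I)) * comp_weight I * comp_weight J))
        * elem_sym_comp (I @ J)) =
      (\<Sum>(s, I, J)\<in>(SIGMA s:{1..c}. compositions s \<times> compositions (b + c - s)).
        if ?cond I J then ?h I J else 0)"
  proof -
    let ?X = "SIGMA s:{1..c}. compositions s \<times> compositions (b + c - s)"
    have len: "sum_list I < q" if "(I, J) \<in> hat_S a (q + 1) b" for I J
      using that by (simp add: hat_S_iff)
    have "(\<Sum>(I, J)\<in>hat_S a (q + 1) b.
        mpconst (of_int ((int (q + 1) - 1 - int (sum_list I)) * comp_weight I * comp_weight J))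
          * elem_sym_comp (I @ J)) = (\<Sum>(I, J)\<in>hat_S a (q + 1) b. ?h I J)"
    proof (rule sum.cong[OF refl], clarify)
      fix I J assume "(I, J) \<in> hat_S a (q + 1) b"
      hence "int (q + 1) - 1 - int (sum_list I) = int (q - sum_list I)" using len by fastforce
      thus "mpconst (of_int ((int (q + 1) - 1 - int (sum_list I)) * comp_weight I * comp_weight J))
          * elem_sym_comp (I @ J) = ?h I J"
        by (simp only: mpconst_of_int elem_sym_comp_def)
    qed
    also have "\<dots> = (\<Sum>(s, I, J)\<in>{(s, I, J) \<in> ?X. ?cond I J \<and> s < q}. ?h I J)"
    proof (rule sum.reindex_bij_witness[where i = snd and j = "\<lambda>(I, J). (sum_list I, I, J)"], goal_cases)
      case (2 x)
      then obtain I J where x: "x = (I, J)" "(I, J) \<in> hat_S a (q + 1) b" by (cases x) auto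
      hence "I \<noteq> []" "I @ J \<in> compositions (b + c)" "sum_list I < q" "?cond I J"
        by (auto simp: hat_S_iff c algebra_simps)
      moreover from this have "1 \<le> sum_list I" by (cases I) (auto simp: compositions_def)
      ultimately show ?case using x c by (auto simp: append_in_compositions)
    next
      case (4 x)
      then obtain s I J where x: "x = (s, I, J)" "1 \<le> s" "s < q" "I \<in> compositions s"
          "J \<in> compositions (b + c - s)" "?cond I J"
        by auto
      have "sum_list I = s" using x(4) by (rule compositionsD)
      moreover from this have "I \<noteq> []" "I @ J \<in> compositions (b + c)"
        using x c by (auto simp: append_in_compositions)
      ultimately show ?case using x by (auto simp: hat_S_iff c algebra_simps)
    qed (auto dest: compositionsD)
    also have "\<dots> = (\<Sum>(s, I, J)\<in>?X. if ?cond I J then ?h I J else 0)"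
    proof (rule sum.mono_neutral_cong_left)
      show "finite ?X" by (intro finite_SigmaI finite_compositions) auto
    qed (auto dest: compositionsD split: if_splits, rule ccontr, auto dest!: compositionsD)
    finally show ?thesis .
  qed
  also have "\<dots> = (\<Sum>s=1..c. \<Sum>I\<in>compositions s. \<Sum>J\<in>compositions (b + c - s). if ?cond I J then ?h I J else 0)"
    by (simp add: sum.Sigma finite_compositions split_def sum.cartesian_product)
  also have "\<dots> = (\<Sum>s=1..c. \<Sum>p=1..c - s. head_series elem_sym b p *
      (\<Sum>k\<le>s. of_int (if q + 1 - p \<le> s - k then int (q - s) * int k else 0) *
        (reduced_series elem_sym (s - k) * elem_sym k * reduced_series elem_sym (c - p - s))))"
  proof (rule sum.cong[OF refl])
    fix s assume s: "s \<in> {1..c}"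
    show "(\<Sum>I\<in>compositions s. \<Sum>J\<in>compositions (b + c - s). if ?cond I J then ?h I J else 0) =
      (\<Sum>p=1..c - s. head_series elem_sym b p *
        (\<Sum>k\<le>s. of_int (if q + 1 - p \<le> s - k then int (q - s) * int k else 0) *
          (reduced_series elem_sym (s - k) * elem_sym k * reduced_series elem_sym (c - p - s))))"
    proof (cases "s = c")
      case True
      \<comment> \<open>\<open>sum_list I = c > q\<close> makes the truncated factor 0; here
        \<open>J\<close> has sum \<open>b\<close> and is too short to have a head.\<close>
      hence "(if ?cond I J then ?h I J else 0) = 0" if "I \<in> compositions s" for I J
        using compositionsD[OF that] c by simp
      hence "(\<Sum>I\<in>compositions s. \<Sum>J\<in>compositions (b + c - s).
          if ?cond I J then ?h I J else 0) = 0"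
        by (intro sum.neutral ballI)
      with True show ?thesis by simp
    next
      case False
      have s': "1 \<le> s" using s by simp
      define t where "t = c - s"
      have t: "1 \<le> t" "b + c - s = b + t" "c - p - s = t - p" for p
        using s False by (auto simp: t_def)
      let ?co = "\<lambda>p k. of_int (if q + 1 - p \<le> s - k then int (q - s) * int k else 0)"
      have from_1: "(\<Sum>k\<le>s. ?co p k * f k) = (\<Sum>k=1..s. ?co p k * f k)"
        for p and f :: "nat \<Rightarrow> (nat, rat) mpseries"
        by (rule sum.mono_neutral_right) (auto simp: not_le)
      have inner: "(\<Sum>J\<in>compositions (b + t). if ?cond (k # A) J then ?h (k # A) J else 0) =
          (\<Sum>p=1..t. head_series elem_sym b p * (?co p k *
            (of_int (reduced_weight A) * ?e A * elem_sym k * reduced_series elem_sym (t - p))))"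
        if k: "k \<in> {1..s}" and A: "A \<in> compositions (s - k)" for k A
        unfolding sum_compositions_head[OF t(1)] head_series_def reduced_series_def sum_distrib_right
        unfolding sum_distrib_left
      proof (intro sum.cong refl)
        fix p r A1 B
        assume p: "p \<in> {1..t}" and r: "r \<in> {..b}" and A1: "A1 \<in> compositions r"
        let ?J = "A1 @ [b + p - r]"
        have "sum_list A1 = r" "sum_list A = s - k" using A1 A by (auto simp: compositionsD)
        moreover from this have "sigma_plus (?J @ B) (b + 1) = b + p"
          using p r sigma_plus_crossing[of A1 "b + 1" "b + p - r" B] by simp
        ultimately have cond: "?cond (k # A) (?J @ B) \<longleftrightarrow> q + 1 - p \<le> s - k"
          and sum: "sum_list (k # A) = s"
          using k by auto
        have h: "?h (k # A) (?J @ B) = of_int (comp_weight ?J) * ?e ?J * (of_int (int (q - s) * int k) *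
            (of_int (reduced_weight A) * ?e A * elem_sym k * (of_int (reduced_weight B) * ?e B)))"
          unfolding sum comp_weight_Cons by (simp add: comp_weight_append mult_ac del: append_assoc)
        show "(if ?cond (k # A) (?J @ B) then ?h (k # A) (?J @ B) else 0) =
            of_int (comp_weight ?J) * ?e ?J * (?co p k *
              (of_int (reduced_weight A) * ?e A * elem_sym k * (of_int (reduced_weight B) * ?e B)))"
          unfolding cond h by simp
      qed
      have "(\<Sum>I\<in>compositions s. \<Sum>J\<in>compositions (b + c - s). if ?cond I J then ?h I J else 0) =
          (\<Sum>k=1..s. \<Sum>A\<in>compositions (s - k). \<Sum>p=1..t. head_series elem_sym b p * (?co p k *
            (of_int (reduced_weight A) * ?e A * elem_sym k * reduced_series elem_sym (t - p))))"
        unfolding t(2) sum_compositions_Cons[OF s'] by (intro sum.cong refl inner)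
      also have "\<dots> = (\<Sum>k=1..s. \<Sum>p=1..t. \<Sum>A\<in>compositions (s - k). head_series elem_sym b p * (?co p k *
            (of_int (reduced_weight A) * ?e A * elem_sym k * reduced_series elem_sym (t - p))))"
        by (intro sum.cong refl sum.swap)
      also have "\<dots> = (\<Sum>p=1..t. \<Sum>k=1..s. \<Sum>A\<in>compositions (s - k). head_series elem_sym b p * (?co p k *
            (of_int (reduced_weight A) * ?e A * elem_sym k * reduced_series elem_sym (t - p))))"
        by (rule sum.swap)
      also have "\<dots> = (\<Sum>p=1..t. head_series elem_sym b p * (\<Sum>k=1..s. ?co p k *
            (reduced_series elem_sym (s - k) * elem_sym k * reduced_series elem_sym (t - p))))"
        unfolding reduced_series_def[of elem_sym "s - _"] sum_distrib_right
        unfolding sum_distrib_left ..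
      finally show ?thesis unfolding from_1 t(3) by (simp only: t_def)
    qed
  qed
  also have "\<dots> = (\<Sum>p=1..c. head_series elem_sym b p * triple_series elem_sym (c - p)
      (\<lambda>r k. if q + 1 - p \<le> r then int (q - (r + k)) * int k else 0))"
  proof -
    have "triple_series elem_sym (c - p) (\<lambda>r k. if q + 1 - p \<le> r then int (q - (r + k)) * int k else 0) =
        (\<Sum>s=1..c - p. \<Sum>k\<le>s. of_int (if q + 1 - p \<le> s - k then int (q - s) * int k else 0) *
        (reduced_series elem_sym (s - k) * elem_sym k * reduced_series elem_sym (c - p - s)))" for p
      unfolding triple_series_diagonal
      by (rule sum.mono_neutral_cong_right) (auto simp: not_le intro!: sum.cong sum.neutral)
    thus ?thesis
      by (subst sum_triangle_swap) (simp only: sum_distrib_left)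
  qed
  finally show ?thesis .
qed

theorem theorem3p10:
  fixes a m b n :: nat
  assumes "n = a + m + b" and "2 \<le> m"
  shows "chromatic_sym (hat_graph a m b) =
      (\<Sum>K | K \<in> compositions n \<and> hat_N m b K \<le> -1.
         mpconst (of_int (- hat_N m b K * comp_weight K) /
                  of_int (Theta_plus K (b + m) + Theta_minus K (b + m - 1))) * elem_sym_comp K)
    + (\<Sum>K | K \<in> compositions n \<and> hat_N m b K \<ge> 1.
         mpconst (of_int (hat_N m b K * comp_weight K)) * elem_sym_comp K)
    + (\<Sum>(I, J)\<in>hat_S a m b.
         mpconst (of_int ((int m - 1 - int (sum_list I)) * comp_weight I * comp_weight J))
           * elem_sym_comp (I @ J))"
proof -
  define q where "q = m - 1"
  define c where "c = a + q + 1"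
  have m: "m = q + 1" and q: "1 \<le> q" using assms(2) by (auto simp: q_def)
  have n: "n = b + c" using assms(1) by (simp add: m c_def)
  have "hat_sym a m b = of_nat q * path_series elem_sym (b + c)
     + (\<Sum>i=1..q. of_nat (q - i) * (path_series elem_sym i * path_series elem_sym (b + c - i)))
     - (\<Sum>s=1..q. (of_nat (q - s) * path_series elem_sym (b + s) + hat_sym 0 s b) * path_series elem_sym (c - s))"
    unfolding m hat_sym_eq_paths path_sym_eq by (simp add: c_def add_ac)
  also have "(\<Sum>s=1..q. (of_nat (q - s) * path_series elem_sym (b + s) + hat_sym 0 s b) * path_series elem_sym (c - s)) =
      (\<Sum>s=1..q. (of_nat (q - s) * path_series elem_sym (b + s) + (of_nat (s - 1) * path_series elem_sym (b + s) -
      (\<Sum>j=1..s - 1. cycle_series elem_sym j * path_series elem_sym (b + s - j)))) * path_series elem_sym (c - s))"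
    by (intro sum.cong refl) (simp add: tadpole_sym_eq)
  also note hat_head_expansion[OF c_def]
  \<comment> \<open>The two summands behind each head are matched separately: the first yields the
    sums over \<open>K\<close>, the second the sum over \<open>hat_S\<close>.\<close>
  also have "(\<Sum>p=1..c. head_series elem_sym b p *
      ((if q < p then of_nat q * reduced_series elem_sym (c - p)
        else triple_series elem_sym (c - p) (\<lambda>r k. if r < q + 1 - p \<and> q + 1 - p \<le> r + k then crossing_coeff q r k else 0))
       + triple_series elem_sym (c - p) (\<lambda>r k. if q + 1 - p \<le> r then int (q - (r + k)) * int k else 0))) =
      (\<Sum>K\<in>compositions n. mpconst (hat_coeff m b K) * elem_sym_comp K) +
      (\<Sum>(I, J)\<in>hat_S a m b.
         mpconst (of_int ((int m - 1 - int (sum_list I)) * comp_weight I * comp_weight J))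
           * elem_sym_comp (I @ J))"
    unfolding n m sum_hat_coeff[OF q c_def] sum_hat_S[OF c_def] distrib_left sum.distrib ..
  also have "(\<Sum>K\<in>compositions n. mpconst (hat_coeff m b K) * elem_sym_comp K) =
      (\<Sum>K | K \<in> compositions n \<and> hat_N m b K \<le> -1.
         mpconst (of_int (- hat_N m b K * comp_weight K) /
                  of_int (Theta_plus K (b + m) + Theta_minus K (b + m - 1))) * elem_sym_comp K)
    + (\<Sum>K | K \<in> compositions n \<and> hat_N m b K \<ge> 1.
         mpconst (of_int (hat_N m b K * comp_weight K)) * elem_sym_comp K)"
  proof -
    have "mpconst (0 :: rat) = (0 :: (nat, rat) mpseries)" using mpconst_of_int[of 0] by simp
    thus ?thesis
      unfolding sum.inter_filter[OF finite_compositions] sum.distrib[symmetric]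
      by (intro sum.cong refl) (auto simp: hat_coeff_def)
  qed
  finally show ?thesis unfolding chromatic_sym_hat_graph[OF assms(2)] .
qed

end
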